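(* Let $G$ be a finite group, and write $I = \operatorname{IrPt}$ and $C = \operatorname{ClPt}$. Let $K \subseteq G$ be a normal subset. Then there is a supercharacter theory $(\mathcal{X},\mathcal{K})$ of $G$ with $K \in \mathcal{K}$ if and only if $K \in (CI)^n(\{K\})$ for all $n > 0$. If this is the case, then for all sufficiently large $n$ the partition $(CI)^n(\{K\})$ is the class partition of the coarsest supercharacter theory of $G$ having $K$ as a superclass. Analogously, let $X \subseteq \operatorname{Irr} G$. Then there is a supercharacter theory $(\mathcal{X},\mathcal{K})$ of $G$ with $X \in \mathcal{X}$ if and only if $X \in (IC)^n(\{X\})$ for all $n > 0$. If this is the case, then for all sufficiently large $n$ the partition $(IC)^n(\{X\})$ is the character partition of the coarsest supercharacter theory of $G$ having $X$ as a member of its character partition.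
   Context: $\operatorname{Irr} G$ is the set of irreducible complex characters of the finite group $G$. For $X \subseteq \operatorname{Irr} G$ put $\sigma_X = \sum_{\chi \in X} \chi(1)\chi$. For $K \subseteq G$ put $\hat{K} = \sum_{g \in K} g \in \mathbb{C}G$; characters are extended linearly to $\mathbb{C}G$. A subset of $G$ is normal ($G$-invariant) if it is a union of conjugacy classes. A partition $\mathcal{K}$ refines (is finer than, written $\mathcal{K} \preceq \mathcal{L}$) a partition $\mathcal{L}$ of the same set if every block of $\mathcal{K}$ is contained in a block of $\mathcal{L}$; then $\mathcal{L}$ is coarser than $\mathcal{K}$. Supercharacter theory: a pair $(\mathcal{X},\mathcal{K})$ with $\mathcal{X}$ a partition of $\operatorname{Irr} G$ (its character partition) and $\mathcal{K}$ a partition of $G$ (its class partition, whose members are the superclasses) such that $|\mathcal{X}| = |\mathcal{K}|$ and, for every $X \in \mathcal{X}$, the character $\sigma_X$ is constant on each member of $\mathcal{K}$. A supercharacter theory $(\mathcal{Y},\mathcal{L})$ is coarser than $(\mathcal{X},\mathcal{K})$ if $\mathcal{X} \preceq \mathcal{Y}$ (for supercharacter theories this is equivalent to $\mathcal{K} \preceq \mathcal{L}$). "The coarsest" with a property means the one that has the property and is coarser than every other one with the property. For a collection $\mathcal{X}$ of subsets of $\operatorname{Irr} G$, $\operatorname{ClPt}(\mathcal{X})$ is the partition of $G$ into equivalence classes of the relation: $g \sim h$ if and only if $\sigma_X(g) = \sigma_X(h)$ for all $X \in \mathcal{X}$. For a collection $\mathcal{K}$ of $G$-invariant subsets of $G$,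 $\operatorname{IrPt}(\mathcal{K})$ is the partition of $\operatorname{Irr} G$ into equivalence classes of the relation: $\chi \sim \psi$ if and only if $\chi(\hat{K})/\chi(1) = \psi(\hat{K})/\psi(1)$ for all $K \in \mathcal{K}$. Here the collections need not be partitions: $\{K\}$ and $\{X\}$ are collections with a single member. Juxtaposition denotes composition of maps, e.g. $CI(\{K\}) = \operatorname{ClPt}(\operatorname{IrPt}(\{K\}))$. *)

theory Defs
  imports
    "HOL-Library.Disjoint_Sets"
    "Jordan_Normal_Form.VS_Connect"
begin

section \<open>Irreducible complex characters\<close>

definition GL :: "nat \<Rightarrow> complex mat monoid"
  where "GL n = units_of (ring_mat TYPE(complex) n ())"

definition representation :: "('a, 'b) monoid_scheme \<Rightarrow> nat \<Rightarrow> ('a \<Rightarrow> complex mat) \<Rightarrow> bool"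
  where "representation G n \<rho> \<longleftrightarrow> \<rho> \<in> hom G (GL n)"

definition invariant_subspace ::
    "('a, 'b) monoid_scheme \<Rightarrow> nat \<Rightarrow> ('a \<Rightarrow> complex mat) \<Rightarrow> complex vec set \<Rightarrow> bool"
  where "invariant_subspace G n \<rho> W \<longleftrightarrow>
    VectorSpace.subspace class_ring W (module_vec TYPE(complex) n) \<and>
    (\<forall>g\<in>carrier G. \<forall>w\<in>W. \<rho> g *\<^sub>v w \<in> W)"

definition irreducible_representation ::
    "('a, 'b) monoid_scheme \<Rightarrow> nat \<Rightarrow> ('a \<Rightarrow> complex mat) \<Rightarrow> bool"
  where "irreducible_representation G n \<rho> \<longleftrightarrow>
    representation G n \<rho> \<and> n > 0 \<and>
    (\<forall>W. invariant_subspace G n \<rho> W \<longrightarrow> W = {0\<^sub>v n} \<or> W = carrier_vec n)"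

definition mat_trace :: "complex mat \<Rightarrow> complex"
  where "mat_trace A = (\<Sum>i<dim_row A. A $$ (i, i))"

text \<open>Characters are fixed to be \<open>undefined\<close> outside the carrier, so that two of them are equal in HOL
  iff they agree on the group.\<close>

definition character_of ::
    "('a, 'b) monoid_scheme \<Rightarrow> ('a \<Rightarrow> complex mat) \<Rightarrow> 'a \<Rightarrow> complex"
  where "character_of G \<rho> = (\<lambda>g\<in>carrier G. mat_trace (\<rho> g))"

definition Irr :: "('a, 'b) monoid_scheme \<Rightarrow> ('a \<Rightarrow> complex) set"
  where "Irr G = {character_of G \<rho> | n \<rho>. irreducible_representation G n \<rho>}"

definition sigma :: "('a, 'b) monoid_scheme \<Rightarrow> ('a \<Rightarrow> complex) set \<Rightarrow> 'a \<Rightarrow> complex"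
  where "sigma G X g = (\<Sum>\<chi>\<in>X. \<chi> \<one>\<^bsub>G\<^esub> * \<chi> g)"

section \<open>Group algebra elements and normal subsets\<close>

text \<open>An element of the group algebra of a finite group is represented by its coefficient function.\<close>

definition set_hat :: "'a set \<Rightarrow> 'a \<Rightarrow> complex"
  where "set_hat K = (\<lambda>g. if g \<in> K then 1 else 0)"

definition lin_ext :: "('a, 'b) monoid_scheme \<Rightarrow> ('a \<Rightarrow> complex) \<Rightarrow> ('a \<Rightarrow> complex) \<Rightarrow> complex"
  where "lin_ext G \<chi> a = (\<Sum>g\<in>carrier G. a g * \<chi> g)"

definition conj_class :: "('a, 'b) monoid_scheme \<Rightarrow> 'a \<Rightarrow> 'a set"
  where "conj_class G x = {g \<otimes>\<^bsub>G\<^esub> x \<otimes>\<^bsub>G\<^esub> inv\<^bsub>G\<^esub> g | g. g \<in> carrier G}"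

definition normal_subset :: "('a, 'b) monoid_scheme \<Rightarrow> 'a set \<Rightarrow> bool"
  where "normal_subset G K \<longleftrightarrow> (\<exists>\<C> \<subseteq> conj_class G ` carrier G. K = \<Union>\<C>)"

section \<open>Supercharacter theories\<close>

definition supercharacter_theory ::
    "('a, 'b) monoid_scheme \<Rightarrow> ('a \<Rightarrow> complex) set set \<Rightarrow> 'a set set \<Rightarrow> bool"
  where "supercharacter_theory G \<X> \<K> \<longleftrightarrow>
    partition_on (Irr G) \<X> \<and> partition_on (carrier G) \<K> \<and> card \<X> = card \<K> \<and>
    (\<forall>X\<in>\<X>. \<forall>K\<in>\<K>. \<exists>c. \<forall>g\<in>K. sigma G X g = c)"

definition coarsest_supercharacter_theory ::
    "('a, 'b) monoid_scheme \<Rightarrow> (('a \<Rightarrow> complex) set set \<Rightarrow> 'a set set \<Rightarrow> bool) \<Rightarrow>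
     ('a \<Rightarrow> complex) set set \<Rightarrow> 'a set set \<Rightarrow> bool"
  where "coarsest_supercharacter_theory G P \<X> \<K> \<longleftrightarrow>
    supercharacter_theory G \<X> \<K> \<and> P \<X> \<K> \<and>
    (\<forall>\<Y> \<L>. supercharacter_theory G \<Y> \<L> \<and> P \<Y> \<L> \<longrightarrow> refines (Irr G) \<Y> \<X>)"

definition ClPt :: "('a, 'b) monoid_scheme \<Rightarrow> ('a \<Rightarrow> complex) set set \<Rightarrow> 'a set set"
  where "ClPt G \<X> =
    carrier G // {(g, h) \<in> carrier G \<times> carrier G. \<forall>X\<in>\<X>. sigma G X g = sigma G X h}"

definition IrPt :: "('a, 'b) monoid_scheme \<Rightarrow> 'a set set \<Rightarrow> ('a \<Rightarrow> complex) set set"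
  where "IrPt G \<K> =
    Irr G // {(\<chi>, \<psi>) \<in> Irr G \<times> Irr G. \<forall>K\<in>\<K>.
      lin_ext G \<chi> (set_hat K) / \<chi> \<one>\<^bsub>G\<^esub> = lin_ext G \<psi> (set_hat K) / \<psi> \<one>\<^bsub>G\<^esub>}"

end

theory Submission
  imports Defs "Jordan_Normal_Form.Spectral_Radius" "HOL-Algebra.Multiplicative_Group"
begin

text \<open>
  A function of \<open>\<chi> \<in> Irr G\<close> and a class function on \<open>G\<close> are related by a Fourier transform: the
  class function \<open>a\<close> goes to \<open>\<chi> \<mapsto> \<chi>(a)/\<chi>(1)\<close>, and the indicator function of \<open>X \<subseteq> Irr G\<close>
  corresponds, up to the factor \<open>|G|\<close>, to the complex conjugate of \<open>\<sigma>\<^sub>X\<close>. The orthogonality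
  relations and the completeness of the irreducible characters say that this is a bijection. A
  partition stands for the space of functions that are constant on its blocks; \<open>IrPt \<K>\<close> is the
  coarsest partition whose function space contains the transforms of all \<open>K \<in> \<K>\<close>, and \<open>ClPt \<X>\<close> is
  the coarsest one whose function space contains all \<open>\<sigma>\<^sub>X\<close>. Three consequences carry the proof.

  \<^item> \<open>ClPt\<close> and \<open>IrPt\<close> preserve refinement (\<open>ClPt_mono\<close>, \<open>IrPt_mono\<close>), since \<open>\<sigma>\<close> and the sums over
    sets are additive over disjoint unions.

  \<^item> A round trip only refines: every \<open>K \<in> \<K>\<close> is a union of blocks of \<open>ClPt (IrPt \<K>)\<close>, because the
    inverse transform writes the indicator function of \<open>K\<close> as a combination of the conjugates of the
    \<open>\<sigma>\<^sub>X\<close>; symmetrically for \<open>X \<in> \<X>\<close> and \<open>IrPt (ClPt \<X>)\<close>.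

  \<^item> \<open>(\<X>, \<K>)\<close> is a supercharacter theory iff \<open>\<X> = IrPt \<K>\<close> and \<open>\<K> = ClPt \<X>\<close>
    (\<open>supercharacter_theory_iff\<close>). Injectivity of the transform gives \<open>|\<X>| \<le> |ClPt \<X>|\<close> and
    \<open>|\<K>| \<le> |IrPt \<K>|\<close>, and equal cardinality turns an injection between the function spaces into a
    bijection.

  The remaining argument is symmetric in classes and characters, and is carried out once, for two
  abstract maps, in the locale \<open>partition_correspondence\<close>. From the first iterate on, the partitions
  \<open>(CI)\<^sup>n {K}\<close> only become finer and \<open>K\<close> is a union of their blocks, so they stabilise at a fixed pair. If
  \<open>K\<close> is a block of every one of them, the fixed pair is a supercharacter theory with superclass
  \<open>K\<close>. Conversely, the class partition of any such theory is, by monotonicity, finer than all these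
  iterates; the nonempty set \<open>K\<close> is then contained in a block of each iterate while being a union of
  its blocks, so it is itself a block. Hence the fixed pair is the coarsest such theory.

  The character theory is built from matrix representations. Schur's lemma yields the
  orthogonality relations. For completeness, a class function \<open>f\<close> with \<open>\<chi>(f) = 0\<close> for all
  irreducible \<open>\<chi>\<close> acts as zero on every irreducible representation; the trace of any representation is
  a sum of traces of irreducible ones, and the trace of the regular representation recovers the
  values of \<open>f\<close>.
\<close>

section \<open>Finite linear systems\<close>

text \<open>Gaussian elimination: an equation with a nonzero coefficient eliminates one unknown, any other
equation holds trivially, so fewer equations than unknowns leave a nonzero solution.\<close>

lemma underdetermined_system:
  fixes m :: "'p \<Rightarrow> 'q \<Rightarrow> complex"
  assumes "finite Q" "finite P" "card Q < card P"
  shows "\<exists>c. (\<exists>p\<in>P. c p \<noteq> 0) \<and> (\<forall>q\<in>Q. (\<Sum>p\<in>P. c p * m p q) = 0)"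
  using assms
proof (induction Q arbitrary: P m rule: finite_induct)
  case empty
  then have "P \<noteq> {}" by auto
  then show ?case by (intro exI[of _ "\<lambda>_. 1"]) auto
next
  case (insert q Q)
  show ?case
  proof (cases "\<exists>r\<in>P. m r q \<noteq> 0")
    case False
    have "card Q < card P" using insert by simp
    then obtain c where "\<exists>p\<in>P. c p \<noteq> 0" "\<forall>q\<in>Q. (\<Sum>p\<in>P. c p * m p q) = 0"
      using insert.IH[OF insert.prems(1), of m] by blast
    moreover have "(\<Sum>p\<in>P. c p * m p q) = 0" using False by (intro sum.neutral) auto
    ultimately show ?thesis by blast
  next
    case True
    then obtain r where r: "r \<in> P" "m r q \<noteq> 0" by blast
    \<comment> \<open>Eliminate the unknown \<open>r\<close> by means of the equation \<open>q\<close>.\<close>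
    define m' where "m' p s = m p s - m p q / m r q * m r s" for p s
    have "card Q < card (P - {r})" using insert r by simp
    then obtain c where c: "\<exists>p\<in>P - {r}. c p \<noteq> 0"
      "\<forall>s\<in>Q. (\<Sum>p\<in>P - {r}. c p * m' p s) = 0"
      using insert.IH[of "P - {r}" m'] insert.prems(1) by auto
    define d where "d p = (if p = r then - (\<Sum>p\<in>P - {r}. c p * m p q) / m r q else c p)" for p
    have d: "(\<Sum>p\<in>P. d p * m p s) = (\<Sum>p\<in>P - {r}. c p * m' p s)" for s
    proof -
      have "(\<Sum>p\<in>P. d p * m p s) = d r * m r s + (\<Sum>p\<in>P - {r}. d p * m p s)"
        using r insert.prems(1) by (simp add: sum.remove)
      also have "(\<Sum>p\<in>P - {r}. d p * m p s) = (\<Sum>p\<in>P - {r}. c p * m p s)"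
        by (intro sum.cong) (auto simp: d_def)
      also have "d r * m r s = - (\<Sum>p\<in>P - {r}. c p * (m p q / m r q * m r s))"
        by (simp add: d_def sum_distrib_right sum_divide_distrib mult.assoc)
      finally show ?thesis
        by (simp add: m'_def right_diff_distrib sum_subtractf)
    qed
    have "(\<Sum>p\<in>P. d p * m p q) = 0"
      unfolding d m'_def using r by simp
    moreover have "\<exists>p\<in>P. d p \<noteq> 0" using c(1) by (auto simp: d_def)
    ultimately show ?thesis using c(2) d by (intro exI[of _ d]) auto
  qed
qed

text \<open>Adjoin the right-hand side as one further unknown. The enlarged homogeneous system is
underdetermined, and independence forces the coefficient of the new unknown to be nonzero.\<close>

lemma square_system_solvable:
  fixes m :: "'p \<Rightarrow> 'q \<Rightarrow> complex"
  assumes fin: "finite P" "finite Q" and card: "card P = card Q"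
    and indep: "\<And>c. \<forall>q\<in>Q. (\<Sum>p\<in>P. c p * m p q) = 0 \<Longrightarrow> \<forall>p\<in>P. c p = 0"
  shows "\<exists>c. \<forall>q\<in>Q. (\<Sum>p\<in>P. c p * m p q) = f q"
proof -
  define m' where "m' p q = (case p of None \<Rightarrow> f q | Some p \<Rightarrow> m p q)" for p q
  define P' where "P' = insert None (Some ` P)"
  have "card Q < card P'" using fin card by (simp add: P'_def card_image)
  then obtain c where c: "\<exists>p\<in>P'. c p \<noteq> 0" "\<forall>q\<in>Q. (\<Sum>p\<in>P'. c p * m' p q) = 0"
    using underdetermined_system[of Q P' m'] fin by (auto simp: P'_def)
  have sum: "(\<Sum>p\<in>P'. c p * m' p q) = c None * f q + (\<Sum>p\<in>P. c (Some p) * m p q)" for q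
    using fin by (simp add: P'_def m'_def sum.reindex o_def)
  have "c None \<noteq> 0"
  proof
    assume 0: "c None = 0"
    then have "\<forall>p\<in>P. c (Some p) = 0" using c(2) sum by (intro indep) auto
    then show False using c(1) 0 by (auto simp: P'_def)
  qed
  have "(\<Sum>p\<in>P. (- c (Some p) / c None) * m p q) = f q" if "q \<in> Q" for q
  proof -
    have "(\<Sum>p\<in>P. (- c (Some p) / c None) * m p q) = - (\<Sum>p\<in>P. c (Some p) * m p q) / c None"
      by (simp add: sum_divide_distrib sum_negf)
    also have "\<dots> = f q" using c(2) that \<open>c None \<noteq> 0\<close> sum[of q]
      by (simp add: field_simps neg_eq_iff_add_eq_0 add.commute)
    finally show ?thesis .
  qed
  then show ?thesis by (intro exI[of _ "\<lambda>p. - c (Some p) / c None"]) auto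
qed

section \<open>Partitions, refinement and unions of blocks\<close>

lemma partition_on_member_eq:
  "partition_on A Q \<Longrightarrow> Y \<in> Q \<Longrightarrow> Z \<in> Q \<Longrightarrow> x \<in> Y \<Longrightarrow> x \<in> Z \<Longrightarrow> Y = Z"
  by (auto simp: partition_on_def disjoint_def)

lemma refines_block_map:
  assumes "refines A P Q"
  obtains f where "f ` P = Q" "\<And>X. X \<in> P \<Longrightarrow> X \<subseteq> f X"
proof -
  have p: "partition_on A P" "partition_on A Q" using assms by (auto simp: refines_def)
  have "\<forall>X\<in>P. \<exists>Y. Y \<in> Q \<and> X \<subseteq> Y" using assms by (auto simp: refines_def)
  then obtain f where f: "\<And>X. X \<in> P \<Longrightarrow> f X \<in> Q \<and> X \<subseteq> f X" by metis
  have "Y \<in> f ` P" if Y: "Y \<in> Q" for Y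
  proof -
    obtain y where y: "y \<in> Y" using Y p(2) by (metis partition_onD3 ex_in_conv)
    then obtain X where X: "X \<in> P" "y \<in> X" using p Y by (auto simp: partition_on_def)
    then have "f X = Y" using partition_on_member_eq[OF p(2), of "f X" Y y] f[of X] Y y by blast
    then show ?thesis using X by blast
  qed
  then have "f ` P = Q" using f by blast
  then show ?thesis using that f by blast
qed

lemma refines_card_le:
  assumes "refines A P Q" "finite P"
  shows "card Q \<le> card P"
  using refines_block_map[OF assms(1)] card_image_le[OF assms(2)] by metis

text \<open>The map from a block to the coarser block containing it is surjective, hence injective if the
cardinalities agree, so no coarse block contains two fine ones.\<close>

lemma refines_card_eq:
  assumes r: "refines A P Q" and fin: "finite P" and card: "card P \<le> card Q"
  shows "P = Q"
proof -
  have p: "partition_on A P" "partition_on A Q" using r by (auto simp: refines_def)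
  obtain f where img: "f ` P = Q" and f: "\<And>X. X \<in> P \<Longrightarrow> X \<subseteq> f X"
    using refines_block_map[OF r] by blast
  have inj: "inj_on f P" using img card fin by (metis card_image_le eq_card_imp_inj_on le_antisym)
  have "X = f X" if X: "X \<in> P" for X
  proof
    show "X \<subseteq> f X" using f X by blast
    show "f X \<subseteq> X"
    proof
      fix x assume x: "x \<in> f X"
      have "f X \<in> Q" using img X by blast
      then obtain X' where X': "X' \<in> P" "x \<in> X'" using p x by (auto simp: partition_on_def)
      then have "f X' = f X"
        using partition_on_member_eq[OF p(2), of "f X'" "f X" x] f[of X'] x \<open>f X \<in> Q\<close> img by blast
      then show "x \<in> X" using inj X X' by (metis inj_onD)
    qed
  qed
  then have "f ` P = P" by force
  then show ?thesis using img by simp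
qed

text \<open>This relation compares a partition with a single set, and thereby with a collection of sets that
need not be a partition, such as \<open>{K}\<close>.\<close>

definition union_of_blocks :: "'a set set \<Rightarrow> 'a set \<Rightarrow> bool"
  where "union_of_blocks P K \<longleftrightarrow> K \<subseteq> \<Union>P \<and> (\<forall>B\<in>P. B \<subseteq> K \<or> B \<inter> K = {})"

lemma union_of_blocks_member: "partition_on A P \<Longrightarrow> K \<in> P \<Longrightarrow> union_of_blocks P K"
  using partition_on_member_eq[of A P _ K] unfolding union_of_blocks_def by auto

lemma union_of_blocks_refines:
  assumes "refines A P Q" "union_of_blocks Q K"
  shows "union_of_blocks P K"
  unfolding union_of_blocks_def
proof (intro conjI ballI)
  have p: "\<Union>P = A" "\<Union>Q = A" and sub: "\<And>X. X \<in> P \<Longrightarrow> \<exists>Y\<in>Q. X \<subseteq> Y"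
    using assms(1) by (auto simp: refines_def partition_on_def)
  have K: "K \<subseteq> \<Union>Q" and blocks: "\<And>Y. Y \<in> Q \<Longrightarrow> Y \<subseteq> K \<or> Y \<inter> K = {}"
    using assms(2) by (auto simp: union_of_blocks_def)
  show "K \<subseteq> \<Union>P" using K p by simp
  fix X assume "X \<in> P"
  then obtain Y where "Y \<in> Q" "X \<subseteq> Y" using sub by blast
  then show "X \<subseteq> K \<or> X \<inter> K = {}" using blocks[of Y] by blast
qed

lemma refines_iff_union_of_blocks:
  assumes "partition_on A P" "partition_on A Q"
  shows "refines A P Q \<longleftrightarrow> (\<forall>K\<in>Q. union_of_blocks P K)"
proof
  assume "refines A P Q"
  then show "\<forall>K\<in>Q. union_of_blocks P K"
    using union_of_blocks_member[OF assms(2)] union_of_blocks_refines by blast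
next
  assume u: "\<forall>K\<in>Q. union_of_blocks P K"
  have "\<exists>Y\<in>Q. B \<subseteq> Y" if B: "B \<in> P" for B
  proof -
    obtain x where x: "x \<in> B" using B assms by (metis partition_onD3 ex_in_conv)
    then have "x \<in> A" using B assms by (auto simp: partition_on_def)
    then obtain Y where "Y \<in> Q" "x \<in> Y" using assms by (auto simp: partition_on_def)
    then show ?thesis using u x B unfolding union_of_blocks_def by blast
  qed
  then show "refines A P Q" using assms by (auto simp: refines_def)
qed

text \<open>The common form of \<open>ClPt\<close> and \<open>IrPt\<close>: the joint level sets in \<open>A\<close> of a family of functions.\<close>

definition level_sets :: "'i set \<Rightarrow> ('i \<Rightarrow> 'a \<Rightarrow> complex) \<Rightarrow> 'a set \<Rightarrow> 'a set set"
  where "level_sets S \<phi> A = A // {(x, y) \<in> A \<times> A. \<forall>i\<in>S. \<phi> i x = \<phi> i y}"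

lemma level_sets_equiv: "equiv A {(x, y) \<in> A \<times> A. \<forall>i\<in>S. \<phi> i x = \<phi> i y}"
  by (rule equivI) (auto simp: refl_on_def sym_def trans_def)

lemma partition_on_level_sets: "partition_on A (level_sets S \<phi> A)"
  unfolding level_sets_def by (rule partition_on_quotient[OF level_sets_equiv])

lemma Union_level_sets: "\<Union>(level_sets S \<phi> A) = A"
  using partition_onD1[OF partition_on_level_sets, of A S \<phi>] by simp

lemma level_sets_member_iff:
  assumes "B \<in> level_sets S \<phi> A" "x \<in> B"
  shows "y \<in> B \<longleftrightarrow> y \<in> A \<and> (\<forall>i\<in>S. \<phi> i x = \<phi> i y)"
  using assms unfolding level_sets_def quotient_def by auto

lemma level_sets_const:
  assumes "B \<in> level_sets S \<phi> A" "x \<in> B" "y \<in> B" "i \<in> S"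
  shows "\<phi> i x = \<phi> i y"
  using level_sets_member_iff[OF assms(1,2), of y] assms(3,4) by simp

lemma refines_level_sets:
  assumes P: "partition_on A P"
    and const: "\<And>B i x y. B \<in> P \<Longrightarrow> i \<in> S \<Longrightarrow> x \<in> B \<Longrightarrow> y \<in> B \<Longrightarrow> \<phi> i x = \<phi> i y"
  shows "refines A P (level_sets S \<phi> A)"
proof -
  have "\<exists>L\<in>level_sets S \<phi> A. B \<subseteq> L" if B: "B \<in> P" for B
  proof -
    have BA: "B \<subseteq> A" using B P by (auto simp: partition_on_def)
    obtain x where x: "x \<in> B" using B P by (metis partition_onD3 ex_in_conv)
    then obtain L where L: "L \<in> level_sets S \<phi> A" "x \<in> L"
      using BA Union_level_sets[of S \<phi> A] by blast
    have "B \<subseteq> L"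
    proof
      fix y assume y: "y \<in> B"
      then show "y \<in> L" using level_sets_member_iff[OF L, of y] const[OF B _ x y] BA by auto
    qed
    then show ?thesis using L(1) by blast
  qed
  then show ?thesis using P partition_on_level_sets by (auto simp: refines_def)
qed

lemma union_of_blocks_level_sets:
  assumes "K \<subseteq> A" and "\<And>x y. x \<in> A \<Longrightarrow> y \<in> A \<Longrightarrow> \<forall>i\<in>S. \<phi> i x = \<phi> i y \<Longrightarrow> x \<in> K \<Longrightarrow> y \<in> K"
  shows "union_of_blocks (level_sets S \<phi> A) K"
  unfolding union_of_blocks_def
proof (intro conjI ballI)
  show "K \<subseteq> \<Union> (level_sets S \<phi> A)"
    using assms(1) by (simp add: Union_level_sets)
  fix B assume B: "B \<in> level_sets S \<phi> A"
  then have BA: "B \<subseteq> A" using Union_level_sets[of S \<phi> A] by blast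
  show "B \<subseteq> K \<or> B \<inter> K = {}"
  proof (cases "B \<inter> K = {}")
    case False
    then obtain x where x: "x \<in> B" "x \<in> K" by blast
    have "y \<in> K" if y: "y \<in> B" for y
    proof (rule assms(2))
      show "x \<in> A" "y \<in> A" using x y BA by auto
      show "\<forall>i\<in>S. \<phi> i x = \<phi> i y" using level_sets_const[OF B x(1) y] by blast
    qed (rule x)
    then show ?thesis by blast
  qed simp
qed

lemma sum_union_of_blocks:
  fixes f :: "'a \<Rightarrow> complex"
  assumes P: "partition_on A P" and fin: "finite A" and u: "union_of_blocks P K"
  shows "(\<Sum>x\<in>K. f x) = (\<Sum>B\<in>{B\<in>P. B \<subseteq> K}. \<Sum>x\<in>B. f x)"
proof -
  have "K \<subseteq> \<Union>{B\<in>P. B \<subseteq> K}"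
  proof
    fix x assume x: "x \<in> K"
    then obtain B where "B \<in> P" "x \<in> B" using u by (auto simp: union_of_blocks_def)
    then have "B \<subseteq> K" using u x by (auto simp: union_of_blocks_def)
    then show "x \<in> \<Union>{B\<in>P. B \<subseteq> K}" using \<open>B \<in> P\<close> \<open>x \<in> B\<close> by auto
  qed
  then have K: "\<Union>{B\<in>P. B \<subseteq> K} = K" by auto
  have "(\<Sum>x\<in>\<Union>{B\<in>P. B \<subseteq> K}. f x) = (\<Sum>B\<in>{B\<in>P. B \<subseteq> K}. \<Sum>x\<in>B. f x)"
  proof (rule sum.Union_disjoint[unfolded o_def])
    show "\<forall>B\<in>{B \<in> P. B \<subseteq> K}. finite B"
      using P fin by (auto simp: partition_on_def intro: finite_subset)
    show "\<forall>B\<in>{B \<in> P. B \<subseteq> K}. \<forall>D\<in>{B \<in> P. B \<subseteq> K}. B \<noteq> D \<longrightarrow> B \<inter> D = {}"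
      using P by (auto simp: partition_on_def disjoint_def)
  qed
  then show ?thesis unfolding K .
qed

lemma sum_partition:
  fixes f :: "'a \<Rightarrow> complex"
  assumes P: "partition_on A P" and fin: "finite A"
  shows "(\<Sum>x\<in>A. f x) = (\<Sum>B\<in>P. \<Sum>x\<in>B. f x)"
proof -
  have "union_of_blocks P A" using P by (auto simp: union_of_blocks_def partition_on_def)
  moreover have "{B\<in>P. B \<subseteq> A} = P" using P by (auto simp: partition_on_def)
  ultimately show ?thesis using sum_union_of_blocks[OF P fin, of A f] by simp
qed

lemma sum_partition_indicator:
  fixes c :: "'a set \<Rightarrow> complex"
  assumes P: "partition_on A P" and fin: "finite P" and B: "B \<in> P" "x \<in> B"
  shows "(\<Sum>D\<in>P. if x \<in> D then c D else 0) = c B"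
proof -
  have "x \<in> D \<longleftrightarrow> D = B" if "D \<in> P" for D
    using partition_on_member_eq[OF P that B(1) _ B(2)] B(2) by blast
  then have "(\<Sum>D\<in>P. if x \<in> D then c D else 0) = (\<Sum>D\<in>P. if D = B then c B else 0)"
    by (intro sum.cong) auto
  then show ?thesis using fin B(1) by simp
qed

section \<open>Iterating a pair of refinement-preserving maps\<close>

text \<open>The predicates \<open>M\<close> and \<open>N\<close> single out the admissible subsets of \<open>A\<close> and \<open>B\<close>. With \<open>I = IrPt\<close> and
\<open>C = ClPt\<close> these are arbitrary subsets of \<open>Irr G\<close> and normal subsets of \<open>G\<close>; for the dual statement
the two sides are exchanged. The maps apply to arbitrary collections of admissible sets, such as \<open>{K}\<close>,
and return partitions.\<close>

locale partition_correspondence =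
  fixes A :: "'a set" and B :: "'b set"
    and M :: "'a set \<Rightarrow> bool" and N :: "'b set \<Rightarrow> bool"
    and I :: "'b set set \<Rightarrow> 'a set set" and C :: "'a set set \<Rightarrow> 'b set set"
  assumes finite_B: "finite B"
    and I_partition: "Ball \<K> N \<Longrightarrow> partition_on A (I \<K>)"
    and C_partition: "Ball \<X> M \<Longrightarrow> partition_on B (C \<X>)"
    and I_blocks: "Ball \<K> N \<Longrightarrow> Ball (I \<K>) M"
    and C_blocks: "Ball \<X> M \<Longrightarrow> Ball (C \<X>) N"
    and I_mono: "partition_on B \<L> \<Longrightarrow> Ball \<L> N \<Longrightarrow> Ball \<K> N \<Longrightarrow>
      Ball \<K> (union_of_blocks \<L>) \<Longrightarrow> refines A (I \<L>) (I \<K>)"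
    and C_mono: "partition_on A \<Y> \<Longrightarrow> Ball \<Y> M \<Longrightarrow> Ball \<X> M \<Longrightarrow>
      Ball \<X> (union_of_blocks \<Y>) \<Longrightarrow> refines B (C \<Y>) (C \<X>)"
    and CI_union: "Ball \<K> N \<Longrightarrow> Ball \<K> (union_of_blocks (C (I \<K>)))"
begin

text \<open>For \<open>I = IrPt\<close> and \<open>C = ClPt\<close> these pairs are exactly the supercharacter theories.\<close>

definition closed_pair :: "'a set set \<Rightarrow> 'b set set \<Rightarrow> bool"
  where "closed_pair \<X> \<K> \<longleftrightarrow> I \<K> = \<X> \<and> C \<X> = \<K> \<and> Ball \<K> N"

lemma closed_pair_partition:
  assumes "closed_pair \<X> \<K>"
  shows "partition_on A \<X>" "partition_on B \<K>" "Ball \<X> M"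
proof -
  have c: "I \<K> = \<X>" "C \<X> = \<K>" "Ball \<K> N" using assms by (auto simp: closed_pair_def)
  show "partition_on A \<X>" and M: "Ball \<X> M" using I_partition I_blocks c(1,3) by blast+
  show "partition_on B \<K>" using C_partition[OF M] c(2) by simp
qed

context
  fixes K assumes K: "N K"
begin

definition iter :: "nat \<Rightarrow> 'b set set"
  where "iter n = ((C \<circ> I) ^^ n) {K}"

lemma iter_0: "iter 0 = {K}" and iter_Suc: "iter (Suc n) = C (I (iter n))"
  by (simp_all add: iter_def)

lemma iter_normal: "Ball (iter n) N"
proof (induction n)
  case 0 show ?case using K by (simp add: iter_0)
next
  case (Suc n) show ?case unfolding iter_Suc by (rule C_blocks[OF I_blocks[OF Suc]])
qed

lemma iter_partition: "n > 0 \<Longrightarrow> partition_on B (iter n)"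
  using C_partition[OF I_blocks[OF iter_normal[of "n - 1"]]] by (cases n) (simp_all add: iter_Suc)

lemma iter_finite: "n > 0 \<Longrightarrow> finite (iter n)"
  using finite_elements[OF finite_B iter_partition] .

lemma iter_Suc_refines: "n > 0 \<Longrightarrow> refines B (iter (Suc n)) (iter n)"
  using refines_iff_union_of_blocks[OF iter_partition[of "Suc n"] iter_partition[of n]]
    CI_union[OF iter_normal, of n] by (simp add: iter_Suc)

text \<open>The start \<open>{K}\<close> is in general not a partition of \<open>B\<close>, so the descending chain begins at index 1.\<close>

lemma iter_refines: "0 < m \<Longrightarrow> m \<le> n \<Longrightarrow> refines B (iter n) (iter m)"
proof (induction n)
  case (Suc n)
  show ?case
  proof (cases "m = Suc n")
    case True
    then show ?thesis using refines_refl[OF iter_partition[of "Suc n"]] by simp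
  next
    case False
    then have "n > 0" "refines B (iter n) (iter m)" using Suc by auto
    then show ?thesis using refines_trans[OF iter_Suc_refines] by blast
  qed
qed simp

lemma iter_union: "n > 0 \<Longrightarrow> union_of_blocks (iter n) K"
proof -
  assume "n > 0"
  moreover have "union_of_blocks (iter 1) K"
    using CI_union[OF iter_normal, of 0] by (simp add: iter_Suc iter_0)
  ultimately show ?thesis using iter_refines[of 1 n] union_of_blocks_refines by fastforce
qed

text \<open>In a chain of successively finer partitions of a finite set, one of maximal cardinality equals all
later ones.\<close>

lemma iter_stabilises: "\<exists>N>0. \<forall>n\<ge>N. closed_pair (I (iter n)) (iter n)"
proof -
  obtain m where m: "m > 0" and max: "\<And>n. n > 0 \<Longrightarrow> card (iter n) \<le> card (iter m)"
  proof -
    define S where "S = (\<lambda>n. card (iter n)) ` {0<..}"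
    have "S \<subseteq> {..card B}"
    proof
      fix k assume "k \<in> S"
      then obtain n where n: "n > 0" "k = card (iter n)" by (auto simp: S_def)
      have "refines B ((\<lambda>x. {x}) ` B) (iter n)"
        unfolding refines_def partition_on_def disjoint_def
        using iter_partition[OF n(1)] by (auto simp: partition_on_def disjoint_def)
      then have "card (iter n) \<le> card ((\<lambda>x. {x}) ` B)" using refines_card_le finite_B by blast
      then show "k \<in> {..card B}" using n card_image_le[OF finite_B, of "\<lambda>x. {x}"] by simp
    qed
    then have "finite S" using finite_subset by blast
    moreover have "S \<noteq> {}" by (auto simp: S_def)
    ultimately have "Max S \<in> S" "\<And>s. s \<in> S \<Longrightarrow> s \<le> Max S" by auto
    then show ?thesis using that unfolding S_def by fastforce
  qed
  have eq: "iter n = iter m" if n: "n \<ge> m" for n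
  proof -
    have "n > 0" using m n by simp
    then show ?thesis
      using refines_card_eq[OF iter_refines[OF m n] iter_finite[OF \<open>n > 0\<close>] max[OF \<open>n > 0\<close>]] by simp
  qed
  have "closed_pair (I (iter n)) (iter n)" if n: "n \<ge> m" for n
  proof -
    have "C (I (iter n)) = iter n" using eq[of n] eq[of "Suc n"] n by (simp add: iter_Suc)
    then show ?thesis using iter_normal by (simp add: closed_pair_def)
  qed
  then show ?thesis using m by blast
qed

text \<open>\<open>K\<close> is a union of blocks of \<open>\<L>\<close>, and applying the monotone maps repeatedly turns \<open>{K}\<close> into the
iterates but leaves the fixed pair \<open>(\<Y>, \<L>)\<close> unchanged.\<close>

lemma closed_pair_refines_iter:
  assumes c: "closed_pair \<Y> \<L>" and KL: "K \<in> \<L>"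
  shows "n > 0 \<Longrightarrow> refines B \<L> (iter n)" "refines A \<Y> (I (iter n))"
proof -
  have cY: "I \<L> = \<Y>" "C \<Y> = \<L>" "Ball \<L> N" using c by (auto simp: closed_pair_def)
  note p = closed_pair_partition[OF c]
  have u: "Ball (iter n) (union_of_blocks \<L>)" for n
  proof (induction n)
    case 0 show ?case using union_of_blocks_member[OF p(2) KL] by (simp add: iter_0)
  next
    case (Suc n)
    then have "refines A \<Y> (I (iter n))" using I_mono[OF p(2) cY(3) iter_normal] cY by simp
    moreover have IM: "Ball (I (iter n)) M" by (rule I_blocks[OF iter_normal])
    ultimately have "refines B \<L> (iter (Suc n))"
      using C_mono[OF p(1) p(3) IM] cY(2) refines_iff_union_of_blocks[of A \<Y> "I (iter n)"]
      by (simp add: iter_Suc refines_def)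
    then show ?case using refines_iff_union_of_blocks[of B \<L> "iter (Suc n)"]
      by (simp add: refines_def)
  qed
  show "n > 0 \<Longrightarrow> refines B \<L> (iter n)"
    using u[of n] iter_partition[of n] p(2) refines_iff_union_of_blocks by blast
  show "refines A \<Y> (I (iter n))"
    using I_mono[OF p(2) cY(3) iter_normal u] cY(1) by simp
qed

text \<open>As \<open>\<L>\<close> is finer than the iterate, some block of the iterate contains \<open>K\<close>; as \<open>K\<close> is also a union
of blocks of the iterate and nonempty, it equals that block.\<close>

lemma closed_pair_imp_member_iter:
  assumes c: "closed_pair \<Y> \<L>" and KL: "K \<in> \<L>" and n: "n > 0"
  shows "K \<in> iter n"
proof -
  obtain L where L: "L \<in> iter n" "K \<subseteq> L"
    using closed_pair_refines_iter(1)[OF c KL n] KL by (auto simp: refines_def)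
  moreover have "K \<noteq> {}" using closed_pair_partition(2)[OF c] KL by (auto simp: partition_on_def)
  ultimately have "L = K" using iter_union[OF n] by (auto simp: union_of_blocks_def)
  then show ?thesis using L by simp
qed

theorem ex_closed_pair_iff: "(\<exists>\<X> \<K>. closed_pair \<X> \<K> \<and> K \<in> \<K>) \<longleftrightarrow> (\<forall>n>0. K \<in> iter n)"
  using closed_pair_imp_member_iter iter_stabilises by blast

theorem coarsest_closed_pair:
  assumes "\<exists>\<X> \<K>. closed_pair \<X> \<K> \<and> K \<in> \<K>"
  shows "\<exists>N. \<forall>n\<ge>N. closed_pair (I (iter n)) (iter n) \<and> K \<in> iter n \<and>
    (\<forall>\<Y> \<L>. closed_pair \<Y> \<L> \<and> K \<in> \<L> \<longrightarrow>
      refines B \<L> (iter n) \<and> refines A \<Y> (I (iter n)))"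
proof -
  obtain N where "N > 0" "\<forall>n\<ge>N. closed_pair (I (iter n)) (iter n)" using iter_stabilises by blast
  moreover have "n > 0" if "n \<ge> N" for n using that \<open>N > 0\<close> by simp
  ultimately show ?thesis using assms closed_pair_imp_member_iter closed_pair_refines_iter
    by (intro exI[of _ N]) blast
qed

end
end

section \<open>Traces and adapted bases\<close>

lemma index_mult_mat_sum:
  assumes "A \<in> carrier_mat n m" "B \<in> carrier_mat m l" "i < n" "j < l"
  shows "(A * B) $$ (i, j) = (\<Sum>k<m. A $$ (i, k) * B $$ (k, j))"
  using assms by (auto simp: scalar_prod_def lessThan_atLeast0)

lemma mat_trace_carrier: "A \<in> carrier_mat n n \<Longrightarrow> mat_trace A = (\<Sum>i<n. A $$ (i, i))"
  by (simp add: mat_trace_def)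

lemma mat_trace_mult_comm:
  assumes "A \<in> carrier_mat n m" "B \<in> carrier_mat m n"
  shows "mat_trace (A * B) = mat_trace (B * A)"
proof -
  have "mat_trace (A * B) = (\<Sum>i<n. \<Sum>k<m. A $$ (i, k) * B $$ (k, i))"
    using assms by (subst mat_trace_carrier[of _ n]) (auto simp: index_mult_mat_sum[OF assms] simp del: index_mult_mat intro!: sum.cong)
  also have "\<dots> = (\<Sum>k<m. \<Sum>i<n. B $$ (k, i) * A $$ (i, k))"
    by (subst sum.swap) (simp add: mult.commute)
  also have "\<dots> = mat_trace (B * A)"
    using assms by (subst mat_trace_carrier[of _ m]) (auto simp: index_mult_mat_sum[OF assms(2,1)] simp del: index_mult_mat intro!: sum.cong)
  finally show ?thesis .
qed

lemma mat_trace_conjugate: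
  assumes "A \<in> carrier_mat n n" "P \<in> carrier_mat n m" "Q \<in> carrier_mat m n" "P * Q = 1\<^sub>m n"
  shows "mat_trace (Q * A * P) = mat_trace A"
proof -
  have "mat_trace (Q * A * P) = mat_trace (P * (Q * A))"
    using assms by (intro mat_trace_mult_comm[of _ m n]) auto
  also have "P * (Q * A) = A" using assms by (simp flip: assoc_mult_mat[of P n m Q n A n])
  finally show ?thesis .
qed

text \<open>A basis of the whole space with as many members as possible in \<open>W\<close>; the indices of those members form
\<open>J\<close>, and \<open>Q\<close> computes coordinates. If some \<open>w \<in> W\<close> had a nonzero coordinate at an index \<open>k\<close> outside
\<open>J\<close>, exchanging the \<open>k\<close>-th basis vector for \<open>w\<close> would give a basis with more members in \<open>W\<close>.\<close>

lemma adapted_basis: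
  fixes W :: "complex vec set"
  assumes W: "W \<subseteq> carrier_vec n"
  obtains P Q J where "P \<in> carrier_mat n n" "Q \<in> carrier_mat n n" "P * Q = 1\<^sub>m n" "Q * P = 1\<^sub>m n"
    "J \<subseteq> {..<n}" "\<And>j. j \<in> J \<Longrightarrow> col P j \<in> W"
    "\<And>w i. w \<in> W \<Longrightarrow> i < n \<Longrightarrow> i \<notin> J \<Longrightarrow> (Q *\<^sub>v w) $ i = 0"
proof -
  define good where "good J P \<longleftrightarrow> J \<subseteq> {..<n} \<and> P \<in> carrier_mat n n \<and> det P \<noteq> 0 \<and>
    (\<forall>j\<in>J. col P j \<in> W)" for J and P :: "complex mat"
  have "good {} (1\<^sub>m n)" by (simp add: good_def)
  moreover have "card J < Suc n" if "good J P" for J P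
    using card_mono[of "{..<n}" J] that by (auto simp: good_def)
  ultimately obtain J where J: "\<exists>P. good J P" and max: "\<And>J'. (\<exists>P. good J' P) \<Longrightarrow> card J' \<le> card J"
    using ex_has_greatest_nat[of "\<lambda>J. \<exists>P. good J P" "{}" card "Suc n"] by blast
  obtain P where P: "good J P" using J by blast
  then have P': "P \<in> carrier_mat n n" "det P \<noteq> 0" "J \<subseteq> {..<n}" "\<And>j. j \<in> J \<Longrightarrow> col P j \<in> W"
    by (auto simp: good_def)
  obtain Q where Q: "Q \<in> carrier_mat n n" "Q * P = 1\<^sub>m n" "P * Q = 1\<^sub>m n"
    using det_non_zero_imp_unit[OF P'(1,2), of "()"] by (auto simp: Units_def ring_mat_simps)
  have "(Q *\<^sub>v w) $ k = 0" if w: "w \<in> W" and k: "k < n" "k \<notin> J" for w k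
  proof (rule ccontr)
    assume nz: "(Q *\<^sub>v w) $ k \<noteq> 0"
    define c where "c = Q *\<^sub>v w"
    have wc: "w \<in> carrier_vec n" using w W by blast
    have c: "c \<in> carrier_vec n" using Q wc by (simp add: c_def)
    have Pc: "P *\<^sub>v c = w"
      using P'(1) Q wc by (simp add: c_def flip: assoc_mult_mat_vec[of P n n Q n w])
    \<comment> \<open>The product \<open>P * E\<close> is \<open>P\<close> with its \<open>k\<close>-th column replaced by \<open>P *\<^sub>v c = w\<close>.\<close>
    define E where "E = mat n n (\<lambda>(i, j). if j = k then c $ i else if i = j then 1 else 0)"
    have E: "E \<in> carrier_mat n n" by (simp add: E_def)
    have colE: "col E j = (if j = k then c else unit_vec n j)" if "j < n" for j
      using that c by (intro eq_vecI) (auto simp: E_def)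
    have "det E \<noteq> 0"
    proof
      assume "det E = 0"
      then obtain v where v: "v \<in> carrier_vec n" "v \<noteq> 0\<^sub>v n" "E *\<^sub>v v = 0\<^sub>v n"
        using det_0_iff_vec_prod_zero_field[OF E] by blast
      have ev: "(E *\<^sub>v v) $ i = (if i = k then 0 else v $ i) + c $ i * v $ k" if i: "i < n" for i
      proof -
        have "(E *\<^sub>v v) $ i = (\<Sum>j<n. E $$ (i, j) * v $ j)"
          using i v(1) E by (auto simp: scalar_prod_def lessThan_atLeast0)
        also have "\<dots> = (\<Sum>j<n. (if j = i then (if i = k then 0 else v $ i) else 0)
            + (if j = k then c $ i * v $ k else 0))"
          using i by (intro sum.cong) (auto simp: E_def)
        also have "\<dots> = (if i = k then 0 else v $ i) + c $ i * v $ k"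
          using i k by (simp add: sum.distrib)
        finally show ?thesis .
      qed
      have vk: "v $ k = 0" using ev[OF k(1)] v(3) nz k by (simp add: c_def[symmetric])
      have "v $ i = 0" if "i < n" for i using ev[OF that] v(3) vk that by (auto split: if_splits)
      then have "v = 0\<^sub>v n" using v(1) by (intro eq_vecI) auto
      then show False using v(2) by simp
    qed
    have col: "col (P * E) j = P *\<^sub>v col E j" if "j < n" for j
      using that P'(1) E by (simp add: col_mult2 del: col_mult)
    have "good (insert k J) (P * E)"
      unfolding good_def
    proof (intro conjI ballI)
      show "insert k J \<subseteq> {..<n}" using P' k by auto
      show "P * E \<in> carrier_mat n n" using P' E by simp
      show "det (P * E) \<noteq> 0" using P' E \<open>det E \<noteq> 0\<close> by (simp add: det_mult)
      fix j assume j: "j \<in> insert k J"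
      then have jn: "j < n" using P' k by auto
      show "col (P * E) j \<in> W"
      proof (cases "j = k")
        case True then show ?thesis using col[OF jn] colE[OF jn] Pc w by simp
      next
        case False
        have "P *\<^sub>v unit_vec n j = col P j"
          using P'(1) jn by (intro eq_vecI) auto
        then show ?thesis using col[OF jn] colE[OF jn] False P'(4) j by simp
      qed
    qed
    then have "card (insert k J) \<le> card J" using max by blast
    then show False using k P'(3) finite_subset[of J "{..<n}"] by simp
  qed
  then show ?thesis using that[of P Q J] P' Q by blast
qed

section \<open>Matrix representations and their invariant subspaces\<close>

lemma subspace_iff:
  "VectorSpace.subspace class_ring W (module_vec TYPE(complex) n) \<longleftrightarrow>
    W \<subseteq> carrier_vec n \<and> 0\<^sub>v n \<in> W \<and> (\<forall>v\<in>W. \<forall>w\<in>W. v + w \<in> W) \<and> (\<forall>c. \<forall>v\<in>W. c \<cdot>\<^sub>v v \<in> W)"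
proof -
  have m: "Module.module class_ring (module_vec TYPE(complex) n)"
    using vec_vs[where 'a = complex, of n] by (simp add: vectorspace_def)
  show ?thesis
    using vec_vs[where 'a = complex, of n] m
    by (auto simp: VectorSpace.subspace_def LinearCombinations.submodule_def module_vec_simps)
qed

lemma representation_carrier:
  "representation G n \<rho> \<Longrightarrow> g \<in> carrier G \<Longrightarrow> \<rho> g \<in> carrier_mat n n"
  by (auto simp: representation_def GL_def units_of_def Units_def ring_mat_simps hom_def Pi_def)

lemma representation_mult:
  "representation G n \<rho> \<Longrightarrow> g \<in> carrier G \<Longrightarrow> h \<in> carrier G \<Longrightarrow> \<rho> (g \<otimes>\<^bsub>G\<^esub> h) = \<rho> g * \<rho> h"
  by (auto simp: representation_def hom_def GL_def units_of_def ring_mat_simps)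

lemma (in group) representation_one:
  assumes "representation G n \<rho>"
  shows "\<rho> \<one> = 1\<^sub>m n"
proof -
  have A: "\<rho> \<one> \<in> carrier_mat n n" using representation_carrier[OF assms] by simp
  have "\<rho> \<one> \<in> Units (ring_mat TYPE(complex) n ())"
    using assms by (auto simp: representation_def GL_def units_of_def hom_def Pi_def)
  then obtain B where B: "B \<in> carrier_mat n n" "\<rho> \<one> * B = 1\<^sub>m n"
    by (auto simp: Units_def ring_mat_simps)
  have "\<rho> \<one> * \<rho> \<one> = \<rho> \<one>" using representation_mult[OF assms, of \<one> \<one>] by simp
  then have "\<rho> \<one> * (\<rho> \<one> * B) = \<rho> \<one> * B" using A B(1) by (simp flip: assoc_mult_mat[of _ n n _ n])
  then show ?thesis using B A by simp
qed

lemma (in group) representationI: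
  assumes c: "\<And>g. g \<in> carrier G \<Longrightarrow> \<rho> g \<in> carrier_mat n n"
    and m: "\<And>g h. g \<in> carrier G \<Longrightarrow> h \<in> carrier G \<Longrightarrow> \<rho> (g \<otimes> h) = \<rho> g * \<rho> h"
    and o: "\<rho> \<one> = 1\<^sub>m n"
  shows "representation G n \<rho>"
proof -
  have "\<rho> g \<in> Units (ring_mat TYPE(complex) n ())" if g: "g \<in> carrier G" for g
  proof -
    have "\<rho> (inv g) * \<rho> g = 1\<^sub>m n" "\<rho> g * \<rho> (inv g) = 1\<^sub>m n"
      using g m[of "inv g" g] m[of g "inv g"] o by simp_all
    then show ?thesis using c[OF g] c[of "inv g"] g by (auto simp: Units_def ring_mat_simps)
  qed
  then show ?thesis using m by (auto simp: representation_def hom_def GL_def units_of_def ring_mat_simps)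
qed

lemma (in group) representation_conjugate:
  assumes r: "representation G n \<rho>"
    and PQ: "P \<in> carrier_mat n n" "Q \<in> carrier_mat n n" "P * Q = 1\<^sub>m n" "Q * P = 1\<^sub>m n"
  shows "representation G n (\<lambda>g. Q * \<rho> g * P)"
proof (rule representationI)
  note c = representation_carrier[OF r]
  show "Q * \<rho> g * P \<in> carrier_mat n n" if "g \<in> carrier G" for g using c[OF that] PQ by simp
  show "Q * \<rho> \<one> * P = 1\<^sub>m n" using PQ representation_one[OF r] by simp
  fix g h assume g: "g \<in> carrier G" and h: "h \<in> carrier G"
  note assoc = assoc_mult_mat[of _ n n _ n _ n]
  have "(Q * \<rho> g * P) * (Q * \<rho> h * P) = Q * \<rho> g * ((P * Q) * (\<rho> h * P))"
    using c[OF g] c[OF h] PQ(1,2) by (simp add: assoc)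
  also have "\<dots> = Q * \<rho> (g \<otimes> h) * P"
    using c[OF g] c[OF h] PQ(1,2) representation_mult[OF r g h] by (simp add: PQ(3) assoc)
  finally show "Q * \<rho> (g \<otimes> h) * P = (Q * \<rho> g * P) * (Q * \<rho> h * P)" by simp
qed

text \<open>Used for the diagonal blocks of a block triangular representation: both the index set of an
invariant subspace and its complement satisfy the multiplicativity assumption.\<close>

lemma (in group) representation_index_set:
  assumes r: "representation G n \<rho>" and J: "J \<subseteq> {..<n}"
    and m: "\<And>g h i j. g \<in> carrier G \<Longrightarrow> h \<in> carrier G \<Longrightarrow> i \<in> J \<Longrightarrow> j \<in> J \<Longrightarrow>
      (\<Sum>k<n. \<rho> g $$ (i, k) * \<rho> h $$ (k, j)) = (\<Sum>k\<in>J. \<rho> g $$ (i, k) * \<rho> h $$ (k, j))"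
  shows "\<exists>\<sigma>. representation G (card J) \<sigma> \<and>
    (\<forall>g\<in>carrier G. mat_trace (\<sigma> g) = (\<Sum>i\<in>J. \<rho> g $$ (i, i)))"
proof -
  have "finite J" using J finite_subset by blast
  then obtain e where e: "bij_betw e {..<card J} J"
    using ex_bij_betw_nat_finite[of J] by (auto simp: lessThan_atLeast0)
  then have eJ: "e i \<in> J" if "i < card J" for i using that by (auto simp: bij_betw_def)
  have en: "e i < n" if "i < card J" for i using eJ[OF that] J by auto
  define \<sigma> where "\<sigma> g = mat (card J) (card J) (\<lambda>(i, j). \<rho> g $$ (e i, e j))" for g
  have \<sigma>: "\<sigma> g \<in> carrier_mat (card J) (card J)" for g by (simp add: \<sigma>_def)
  note c = representation_carrier[OF r]
  have "representation G (card J) \<sigma>"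
  proof (rule representationI)
    show "\<sigma> g \<in> carrier_mat (card J) (card J)" for g by (rule \<sigma>)
    have "e i = e j \<longleftrightarrow> i = j" if "i < card J" "j < card J" for i j
      using e that by (auto simp: bij_betw_def inj_on_def)
    then show "\<sigma> \<one> = 1\<^sub>m (card J)"
      by (intro eq_matI) (auto simp: \<sigma>_def representation_one[OF r] en)
    fix g h assume g: "g \<in> carrier G" and h: "h \<in> carrier G"
    show "\<sigma> (g \<otimes> h) = \<sigma> g * \<sigma> h"
    proof (rule eq_matI)
      fix i j assume "i < dim_row (\<sigma> g * \<sigma> h)" "j < dim_col (\<sigma> g * \<sigma> h)"
      then have ij: "i < card J" "j < card J" using \<sigma> by (auto simp: \<sigma>_def)
      have "(\<sigma> g * \<sigma> h) $$ (i, j) = (\<Sum>k<card J. \<rho> g $$ (e i, e k) * \<rho> h $$ (e k, e j))"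
        unfolding index_mult_mat_sum[OF \<sigma> \<sigma> ij] using ij by (simp add: \<sigma>_def)
      also have "\<dots> = (\<Sum>k\<in>J. \<rho> g $$ (e i, k) * \<rho> h $$ (k, e j))"
        by (rule sum.reindex_bij_betw[OF e])
      also have "\<dots> = (\<rho> g * \<rho> h) $$ (e i, e j)"
        using index_mult_mat_sum[OF c[OF g] c[OF h]] en ij m g h eJ by simp
      finally show "\<sigma> (g \<otimes> h) $$ (i, j) = (\<sigma> g * \<sigma> h) $$ (i, j)"
        using ij representation_mult[OF r g h] by (simp add: \<sigma>_def)
    qed (auto simp: \<sigma>_def)
  qed
  moreover have "mat_trace (\<sigma> g) = (\<Sum>i\<in>J. \<rho> g $$ (i, i))" for g
    unfolding mat_trace_carrier[OF \<sigma>] using sum.reindex_bij_betw[OF e, of "\<lambda>i. \<rho> g $$ (i, i)"]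
    by (simp add: \<sigma>_def)
  ultimately show ?thesis by blast
qed

text \<open>With respect to a basis adapted to an invariant subspace the representation is block triangular, and
the two diagonal blocks are representations of smaller dimension.\<close>

lemma (in group) reducible_trace_split:
  assumes r: "representation G n \<rho>" and n: "n > 0" and nirr: "\<not> irreducible_representation G n \<rho>"
  shows "\<exists>n1 n2 \<sigma>1 \<sigma>2. n1 < n \<and> n2 < n \<and> representation G n1 \<sigma>1 \<and> representation G n2 \<sigma>2 \<and>
    (\<forall>g\<in>carrier G. mat_trace (\<rho> g) = mat_trace (\<sigma>1 g) + mat_trace (\<sigma>2 g))"
proof -
  obtain W where inv: "invariant_subspace G n \<rho> W" and W: "W \<noteq> {0\<^sub>v n}" "W \<noteq> carrier_vec n"
    using r n nirr by (auto simp: irreducible_representation_def)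
  then have sub: "W \<subseteq> carrier_vec n" "0\<^sub>v n \<in> W" "\<And>v w. v \<in> W \<Longrightarrow> w \<in> W \<Longrightarrow> v + w \<in> W"
    "\<And>c v. v \<in> W \<Longrightarrow> c \<cdot>\<^sub>v v \<in> W" and stable: "\<And>g w. g \<in> carrier G \<Longrightarrow> w \<in> W \<Longrightarrow> \<rho> g *\<^sub>v w \<in> W"
    by (auto simp: invariant_subspace_def subspace_iff)
  obtain P Q J where PQ: "P \<in> carrier_mat n n" "Q \<in> carrier_mat n n" "P * Q = 1\<^sub>m n" "Q * P = 1\<^sub>m n"
    and J: "J \<subseteq> {..<n}" "\<And>j. j \<in> J \<Longrightarrow> col P j \<in> W"
    and zero: "\<And>w i. w \<in> W \<Longrightarrow> i < n \<Longrightarrow> i \<notin> J \<Longrightarrow> (Q *\<^sub>v w) $ i = 0"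
    using adapted_basis[OF sub(1)] by blast
  define \<tau> where "\<tau> g = Q * \<rho> g * P" for g
  have \<tau>: "representation G n \<tau>"
    unfolding \<tau>_def using representation_conjugate[OF r PQ] .
  note c = representation_carrier[OF r]
  have \<tau>0: "\<tau> g $$ (i, j) = 0" if g: "g \<in> carrier G" and i: "i < n" "i \<notin> J" and j: "j \<in> J" for g i j
  proof -
    have jn: "j < n" using j J by auto
    have P: "col P j \<in> carrier_vec n" using PQ jn by simp
    have "\<tau> g = Q * (\<rho> g * P)" unfolding \<tau>_def using c[OF g] PQ by (intro assoc_mult_mat[of _ n n _ n]) auto
    then have "col (\<tau> g) j = Q *\<^sub>v (\<rho> g *\<^sub>v col P j)"
      using c[OF g] PQ jn by (simp add: col_mult2[of _ n n _ n] del: col_mult)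
    then have "(col (\<tau> g) j) $ i = 0" using zero[OF stable[OF g J(2)[OF j]] i] by simp
    then show ?thesis using representation_carrier[OF \<tau> g] i jn by simp
  qed
  have split: "(\<Sum>k<n. f k) = (\<Sum>k\<in>J. f k) + (\<Sum>k\<in>{..<n} - J. f k)" for f :: "nat \<Rightarrow> complex"
    using J by (simp add: sum.subset_diff add.commute)
  obtain \<sigma>1 where \<sigma>1: "representation G (card J) \<sigma>1"
    "\<forall>g\<in>carrier G. mat_trace (\<sigma>1 g) = (\<Sum>i\<in>J. \<tau> g $$ (i, i))"
    using representation_index_set[OF \<tau> J(1)] \<tau>0 unfolding split by auto
  obtain \<sigma>2 where \<sigma>2: "representation G (card ({..<n} - J)) \<sigma>2"
    "\<forall>g\<in>carrier G. mat_trace (\<sigma>2 g) = (\<Sum>i\<in>{..<n} - J. \<tau> g $$ (i, i))"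
    using representation_index_set[OF \<tau>, of "{..<n} - J"] \<tau>0 unfolding split by auto
  have "mat_trace (\<rho> g) = mat_trace (\<sigma>1 g) + mat_trace (\<sigma>2 g)" if g: "g \<in> carrier G" for g
  proof -
    have "mat_trace (\<rho> g) = mat_trace (\<tau> g)"
      unfolding \<tau>_def using mat_trace_conjugate[OF c[OF g] PQ(1-3)] by simp
    then show ?thesis
      using \<sigma>1 \<sigma>2 g split by (simp add: mat_trace_carrier[OF representation_carrier[OF \<tau> g]])
  qed
  moreover have "J \<noteq> {..<n}"
  proof
    assume Jn: "J = {..<n}"
    have "v \<in> W" if v: "v \<in> carrier_vec n" for v
    proof -
      define u where "u = Q *\<^sub>v v"
      have u: "u \<in> carrier_vec n" "P *\<^sub>v u = v"
        using PQ v by (simp_all add: u_def flip: assoc_mult_mat_vec[of P n n Q n v])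
      have part: "vec n (\<lambda>i. \<Sum>k<m. P $$ (i, k) * u $ k) \<in> W" if "m \<le> n" for m
        using that
      proof (induction m)
        case 0
        have "vec n (\<lambda>i. \<Sum>k<0. P $$ (i, k) * u $ k) = 0\<^sub>v n" by (intro eq_vecI) auto
        then show ?case using sub(2) by simp
      next
        case (Suc m)
        have "vec n (\<lambda>i. \<Sum>k<Suc m. P $$ (i, k) * u $ k)
          = vec n (\<lambda>i. \<Sum>k<m. P $$ (i, k) * u $ k) + u $ m \<cdot>\<^sub>v col P m"
          using Suc.prems PQ(1) by (intro eq_vecI) (auto simp: mult.commute)
        then show ?case using Suc J(2)[of m] sub(3,4) by (simp add: Jn)
      qed
      have "vec n (\<lambda>i. \<Sum>k<n. P $$ (i, k) * u $ k) = P *\<^sub>v u"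
        using PQ(1) u(1) by (intro eq_vecI) (auto simp: scalar_prod_def lessThan_atLeast0)
      then show ?thesis using part[of n] u by simp
    qed
    then show False using W sub(1) by blast
  qed
  moreover have "J \<noteq> {}"
  proof
    assume J0: "J = {}"
    have "w = 0\<^sub>v n" if w: "w \<in> W" for w
    proof -
      have wc: "w \<in> carrier_vec n" using w sub by blast
      have "Q *\<^sub>v w = 0\<^sub>v n" using zero[OF w] PQ by (intro eq_vecI) (auto simp: J0)
      then have "P *\<^sub>v (Q *\<^sub>v w) = 0\<^sub>v n" using PQ by (simp add: mult_mat_vec_def) auto
      then show ?thesis using PQ wc by (simp flip: assoc_mult_mat_vec[of P n n Q n w])
    qed
    then show False using W sub(2) by blast
  qed
  ultimately show ?thesis
    using \<sigma>1(1) \<sigma>2(1) J(1) psubset_card_mono[of "{..<n}" J] psubset_card_mono[of "{..<n}" "{..<n} - J"]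
    by (intro exI[of _ "card J"] exI[of _ "card ({..<n} - J)"] exI[of _ \<sigma>1] exI[of _ \<sigma>2]) auto
qed

section \<open>Schur's lemma\<close>

text \<open>The kernel of \<open>T\<close> is invariant under \<open>\<psi>\<close> and its image under \<open>\<rho>\<close>; by irreducibility \<open>T\<close> is
injective and surjective. The columns of \<open>S\<close> are preimages of the standard basis vectors.\<close>

lemma schur_invertible:
  assumes \<rho>: "irreducible_representation G n \<rho>" and \<psi>: "irreducible_representation G m \<psi>"
    and T: "T \<in> carrier_mat n m" "\<And>g. g \<in> carrier G \<Longrightarrow> \<rho> g * T = T * \<psi> g" "T \<noteq> 0\<^sub>m n m"
  shows "\<exists>S \<in> carrier_mat m n. T * S = 1\<^sub>m n \<and> S * T = 1\<^sub>m m"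
proof -
  have r: "representation G n \<rho>" "representation G m \<psi>" "n > 0" "m > 0"
    using \<rho> \<psi> by (auto simp: irreducible_representation_def)
  note c = representation_carrier[OF r(1)] representation_carrier[OF r(2)]
  have swap: "T *\<^sub>v (\<psi> g *\<^sub>v v) = \<rho> g *\<^sub>v (T *\<^sub>v v)" if "g \<in> carrier G" "v \<in> carrier_vec m" for g v
    using that T c[OF that(1)] by (metis assoc_mult_mat_vec)
  have mv0: "A *\<^sub>v 0\<^sub>v k = 0\<^sub>v l" if "A \<in> carrier_mat l k" for A :: "complex mat" and k l
    using that by (intro eq_vecI) auto
  define W1 where "W1 = {v \<in> carrier_vec m. T *\<^sub>v v = 0\<^sub>v n}"
  have "invariant_subspace G m \<psi> W1"
    unfolding invariant_subspace_def subspace_iff W1_def using T(1) c swap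
    by (auto simp: mult_add_distrib_mat_vec[of _ n m] mult_mat_vec[of _ n m] mv0[of _ n n] mv0[of _ n m]
        intro: mult_mat_vec_carrier)
  then have "W1 = {0\<^sub>v m} \<or> W1 = carrier_vec m"
    using \<psi> by (auto simp: irreducible_representation_def)
  moreover have "W1 \<noteq> carrier_vec m"
  proof
    assume W1: "W1 = carrier_vec m"
    have "T $$ (i, j) = 0" if "i < n" "j < m" for i j
    proof -
      have "unit_vec m j \<in> W1" using W1 by simp
      then have "(T *\<^sub>v unit_vec m j) $ i = 0" using that by (simp add: W1_def)
      then show ?thesis using that T(1) by simp
    qed
    then show False using T(1,3) by (auto intro!: eq_matI)
  qed
  ultimately have W1: "W1 = {0\<^sub>v m}" by blast
  define W2 where "W2 = {T *\<^sub>v v | v. v \<in> carrier_vec m}"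
  have "invariant_subspace G n \<rho> W2"
    unfolding invariant_subspace_def subspace_iff
  proof (intro conjI ballI allI)
    show "W2 \<subseteq> carrier_vec n" using T(1) by (auto simp: W2_def)
    show "0\<^sub>v n \<in> W2" unfolding W2_def using mv0[OF T(1)] by (auto intro!: exI[of _ "0\<^sub>v m"])
    show "v + w \<in> W2" if vw: "v \<in> W2" "w \<in> W2" for v w
    proof -
      obtain x y where "v = T *\<^sub>v x" "w = T *\<^sub>v y" "x \<in> carrier_vec m" "y \<in> carrier_vec m"
        using vw by (auto simp: W2_def)
      then show ?thesis using T(1) unfolding W2_def
        by (auto intro!: exI[of _ "x + y"] simp: mult_add_distrib_mat_vec[of _ n m])
    qed
    show "a \<cdot>\<^sub>v v \<in> W2" if v: "v \<in> W2" for a v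
    proof -
      obtain x where "v = T *\<^sub>v x" "x \<in> carrier_vec m" using v by (auto simp: W2_def)
      then show ?thesis using T(1) unfolding W2_def
        by (auto intro!: exI[of _ "a \<cdot>\<^sub>v x"] simp: mult_mat_vec[of _ n m])
    qed
    show "\<rho> g *\<^sub>v w \<in> W2" if g: "g \<in> carrier G" and w: "w \<in> W2" for g w
    proof -
      obtain x where "w = T *\<^sub>v x" "x \<in> carrier_vec m" using w by (auto simp: W2_def)
      then show ?thesis using c(2)[OF g] swap[OF g, of x] unfolding W2_def
        by (auto intro!: exI[of _ "\<psi> g *\<^sub>v x"])
    qed
  qed
  then have "W2 = {0\<^sub>v n} \<or> W2 = carrier_vec n"
    using \<rho> by (auto simp: irreducible_representation_def)
  moreover have "W2 \<noteq> {0\<^sub>v n}"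
    using \<open>W1 \<noteq> carrier_vec m\<close> by (auto simp: W1_def W2_def)
  ultimately have W2: "W2 = carrier_vec n" by blast
  have "\<exists>v. v \<in> carrier_vec m \<and> T *\<^sub>v v = unit_vec n i" for i
  proof -
    have "unit_vec n i \<in> W2" using W2 by simp
    then show ?thesis unfolding W2_def by auto
  qed
  then obtain s where s: "\<And>i. s i \<in> carrier_vec m" "\<And>i. T *\<^sub>v s i = unit_vec n i" by metis
  define S where "S = mat m n (\<lambda>(j, i). s i $ j)"
  have S: "S \<in> carrier_mat m n" by (simp add: S_def)
  have colS: "col S i = s i" if "i < n" for i using that s(1)[of i] by (intro eq_vecI) (auto simp: S_def)
  have TS: "T * S = 1\<^sub>m n"
  proof (rule eq_matI)
    fix i j assume "i < dim_row (1\<^sub>m n :: complex mat)" "j < dim_col (1\<^sub>m n :: complex mat)"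
    then have ij: "i < n" "j < n" by auto
    have "(T * S) $$ (i, j) = (T *\<^sub>v col S j) $ i" using ij T(1) S by simp
    then show "(T * S) $$ (i, j) = 1\<^sub>m n $$ (i, j)" using ij by (simp add: colS s(2))
  qed (use T S in auto)
  have ST: "S * T = 1\<^sub>m m"
  proof (rule eq_matI)
    fix i j assume "i < dim_row (1\<^sub>m m :: complex mat)" "j < dim_col (1\<^sub>m m :: complex mat)"
    then have ij: "i < m" "j < m" by auto
    define v where "v = col (S * T) j - unit_vec m j"
    have v: "v \<in> carrier_vec m" by (rule carrier_vecI) (simp add: v_def)
    have "T *\<^sub>v col (S * T) j = col (T * (S * T)) j" using T(1) S ij by (simp add: col_mult2[of _ n m _ m] del: col_mult)
    also have "T * (S * T) = T" using T(1) S TS by (simp flip: assoc_mult_mat[of T n m S n T m])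
    also have "col T j = T *\<^sub>v unit_vec m j" using T(1) ij by (intro eq_vecI) auto
    finally have "T *\<^sub>v v = 0\<^sub>v n"
      unfolding v_def using T(1) S ij by (subst mult_minus_distrib_mat_vec[of _ n m]) auto
    then have "v = 0\<^sub>v m" using W1 v by (auto simp: W1_def)
    then have "v $ i = 0" using ij by simp
    then show "(S * T) $$ (i, j) = 1\<^sub>m m $$ (i, j)" using ij S T by (auto simp: v_def)
  qed (use T S in auto)
  show ?thesis using S TS ST by blast
qed

lemma schur_trace_eq:
  assumes \<rho>: "irreducible_representation G n \<rho>" and \<psi>: "irreducible_representation G m \<psi>"
    and T: "T \<in> carrier_mat n m" "\<And>g. g \<in> carrier G \<Longrightarrow> \<rho> g * T = T * \<psi> g" "T \<noteq> 0\<^sub>m n m"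
    and g: "g \<in> carrier G"
  shows "mat_trace (\<rho> g) = mat_trace (\<psi> g)"
proof -
  have r: "\<rho> g \<in> carrier_mat n n" "\<psi> g \<in> carrier_mat m m"
    using \<rho> \<psi> g representation_carrier by (auto simp: irreducible_representation_def)
  obtain S where S: "S \<in> carrier_mat m n" "T * S = 1\<^sub>m n" "S * T = 1\<^sub>m m"
    using schur_invertible[OF \<rho> \<psi> T] by blast
  have "S * \<rho> g * T = S * (T * \<psi> g)" using S r T(1) T(2)[OF g] by (simp add: assoc_mult_mat[of S m n "\<rho> g" n T m])
  also have "\<dots> = \<psi> g" using S r T(1) by (simp flip: assoc_mult_mat[of S m n T m "\<psi> g" m])
  finally show ?thesis using mat_trace_conjugate[OF r(1) T(1) S(1,2)] by simp
qed

text \<open>Subtracting an eigenvalue from \<open>T\<close> leaves an intertwiner with nonzero kernel, which must vanish.\<close>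

lemma schur_scalar:
  assumes \<rho>: "irreducible_representation G n \<rho>"
    and T: "T \<in> carrier_mat n n" "\<And>g. g \<in> carrier G \<Longrightarrow> \<rho> g * T = T * \<rho> g"
  shows "\<exists>c. T = c \<cdot>\<^sub>m 1\<^sub>m n"
proof -
  have r: "representation G n \<rho>" "n > 0" using \<rho> by (auto simp: irreducible_representation_def)
  note c = representation_carrier[OF r(1)]
  obtain e where "eigenvalue T e"
    using spectrum_non_empty[OF T(1) r(2)] by (auto simp: spectrum_def)
  then obtain v where v: "v \<in> carrier_vec n" "v \<noteq> 0\<^sub>v n" "T *\<^sub>v v = e \<cdot>\<^sub>v v"
    using T(1) by (auto simp: eigenvalue_def eigenvector_def)
  define D where "D = T - e \<cdot>\<^sub>m 1\<^sub>m n"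
  have D: "D \<in> carrier_mat n n" unfolding D_def by (intro minus_carrier_mat) simp
  have "D = 0\<^sub>m n n"
  proof (rule ccontr)
    assume "D \<noteq> 0\<^sub>m n n"
    moreover have "\<rho> g * D = D * \<rho> g" if g: "g \<in> carrier G" for g
      using T c[OF g] g unfolding D_def
      by (simp add: mult_minus_distrib_mat[of _ n n _ n] minus_mult_distrib_mat[of _ n n _ _ n]
          mult_smult_distrib[of _ n n _ n] mult_smult_assoc_mat[of _ n n _ n])
    ultimately obtain S where S: "S \<in> carrier_mat n n" "S * D = 1\<^sub>m n"
      using schur_invertible[OF \<rho> \<rho> D] by blast
    have "D *\<^sub>v v = T *\<^sub>v v - (e \<cdot>\<^sub>m 1\<^sub>m n) *\<^sub>v v"
      unfolding D_def using T(1) v(1) by (intro minus_mult_distrib_mat_vec[of _ n n]) auto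
    also have "\<dots> = 0\<^sub>v n" using v by (intro eq_vecI) auto
    finally have "S *\<^sub>v (D *\<^sub>v v) = 0\<^sub>v n" using S(1) by (intro eq_vecI) auto
    moreover have "S *\<^sub>v (D *\<^sub>v v) = v" using S D v(1) by (simp flip: assoc_mult_mat_vec[of S n n D n v])
    ultimately show False using v(2) by simp
  qed
  have "T = e \<cdot>\<^sub>m 1\<^sub>m n"
  proof (rule eq_matI)
    fix i j assume ij: "i < dim_row (e \<cdot>\<^sub>m 1\<^sub>m n)" "j < dim_col (e \<cdot>\<^sub>m 1\<^sub>m n)"
    then have "D $$ (i, j) = 0" using \<open>D = 0\<^sub>m n n\<close> by simp
    then show "T $$ (i, j) = (e \<cdot>\<^sub>m 1\<^sub>m n) $$ (i, j)" using ij T(1) by (simp add: D_def)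
  qed (use T in auto)
  then show ?thesis by blast
qed

section \<open>Orthogonality of traces\<close>

locale finite_group = group +
  assumes finite_carrier [simp]: "finite (carrier G)"
begin

lemma card_carrier_pos: "card (carrier G) > 0"
  by (simp add: card_gt_0_iff) (use one_closed in blast)

lemma sum_translate: "h \<in> carrier G \<Longrightarrow> (\<Sum>g\<in>carrier G. f (h \<otimes> g)) = (\<Sum>g\<in>carrier G. f g)"
  by (rule sum.reindex_bij_witness[of _ "\<lambda>g. inv h \<otimes> g" "\<lambda>g. h \<otimes> g"])
    (auto simp: m_assoc[symmetric])

text \<open>\<open>T\<close> is the average \<open>\<Sum>\<^sub>g \<rho>(g) E \<psi>(g)\<^sup>-\<^sup>1\<close> of the matrix unit \<open>E\<close> at position \<open>(i, j)\<close>.\<close>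

lemma average_intertwines:
  assumes \<rho>: "representation G n \<rho>" and \<psi>: "representation G m \<psi>"
    and i: "i < n" and j: "j < m" and h: "h \<in> carrier G"
  defines "T \<equiv> mat n m (\<lambda>(k, l). \<Sum>g\<in>carrier G. \<rho> g $$ (k, i) * \<psi> (inv g) $$ (j, l))"
  shows "\<rho> h * T = T * \<psi> h"
proof (rule eq_matI)
  note c = representation_carrier[OF \<rho>] representation_carrier[OF \<psi>]
  have T: "T \<in> carrier_mat n m" by (simp add: T_def)
  show "dim_row (\<rho> h * T) = dim_row (T * \<psi> h)" "dim_col (\<rho> h * T) = dim_col (T * \<psi> h)"
    using c h T by auto
  fix k l assume "k < dim_row (T * \<psi> h)" "l < dim_col (T * \<psi> h)"
  then have k: "k < n" and l: "l < m" using T c h by auto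
  have "(\<rho> h * T) $$ (k, l) = (\<Sum>p<n. \<rho> h $$ (k, p) * (\<Sum>g\<in>carrier G. \<rho> g $$ (p, i) * \<psi> (inv g) $$ (j, l)))"
    unfolding index_mult_mat_sum[OF c(1)[OF h] T k l] using l by (simp add: T_def)
  also have "\<dots> = (\<Sum>g\<in>carrier G. (\<Sum>p<n. \<rho> h $$ (k, p) * \<rho> g $$ (p, i)) * \<psi> (inv g) $$ (j, l))"
    unfolding sum_distrib_left sum_distrib_right mult.assoc by (rule sum.swap)
  also have "\<dots> = (\<Sum>g\<in>carrier G. \<rho> (h \<otimes> g) $$ (k, i) * \<psi> (inv g) $$ (j, l))"
    using index_mult_mat_sum[OF c(1) c(1) k i] representation_mult[OF \<rho>] h by simp
  also have "\<dots> = (\<Sum>g\<in>carrier G. \<rho> (h \<otimes> g) $$ (k, i) * \<psi> (inv (h \<otimes> g) \<otimes> h) $$ (j, l))"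
    using h by (intro sum.cong) (auto simp: inv_mult_group m_assoc)
  also have "\<dots> = (\<Sum>g\<in>carrier G. \<rho> g $$ (k, i) * \<psi> (inv g \<otimes> h) $$ (j, l))"
    by (rule sum_translate[OF h])
  also have "\<dots> = (\<Sum>g\<in>carrier G. \<rho> g $$ (k, i) * (\<Sum>p<m. \<psi> (inv g) $$ (j, p) * \<psi> h $$ (p, l)))"
    using index_mult_mat_sum[OF c(2) c(2)[OF h] j l] representation_mult[OF \<psi>] h by simp
  also have "\<dots> = (\<Sum>p<m. (\<Sum>g\<in>carrier G. \<rho> g $$ (k, i) * \<psi> (inv g) $$ (j, p)) * \<psi> h $$ (p, l))"
    unfolding sum_distrib_left sum_distrib_right mult.assoc by (rule sum.swap)
  also have "\<dots> = (T * \<psi> h) $$ (k, l)"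
    unfolding index_mult_mat_sum[OF T c(2)[OF h] k l] using k by (simp add: T_def)
  finally show "(\<rho> h * T) $$ (k, l) = (T * \<psi> h) $$ (k, l)" .
qed

lemma trace_orthogonality_distinct:
  assumes \<rho>: "irreducible_representation G n \<rho>" and \<psi>: "irreducible_representation G m \<psi>"
    and ne: "\<exists>g\<in>carrier G. mat_trace (\<rho> g) \<noteq> mat_trace (\<psi> g)"
  shows "(\<Sum>g\<in>carrier G. mat_trace (\<rho> g) * mat_trace (\<psi> (inv g))) = 0"
proof -
  have r: "representation G n \<rho>" "representation G m \<psi>"
    using \<rho> \<psi> by (auto simp: irreducible_representation_def)
  note c = representation_carrier[OF r(1)] representation_carrier[OF r(2)]
  have zero: "(\<Sum>g\<in>carrier G. \<rho> g $$ (i, i) * \<psi> (inv g) $$ (j, j)) = 0" if i: "i < n" and j: "j < m" for i j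
  proof -
    define T where "T = mat n m (\<lambda>(k, l). \<Sum>g\<in>carrier G. \<rho> g $$ (k, i) * \<psi> (inv g) $$ (j, l))"
    have "T = 0\<^sub>m n m"
      using schur_trace_eq[OF \<rho> \<psi>, of T] average_intertwines[OF r i j] ne by (auto simp: T_def)
    then have "T $$ (i, j) = 0" using i j by simp
    then show ?thesis using i j by (simp add: T_def)
  qed
  have "(\<Sum>g\<in>carrier G. mat_trace (\<rho> g) * mat_trace (\<psi> (inv g)))
    = (\<Sum>g\<in>carrier G. \<Sum>i<n. \<Sum>j<m. \<rho> g $$ (i, i) * \<psi> (inv g) $$ (j, j))"
    by (simp add: mat_trace_carrier[OF c(1)] mat_trace_carrier[OF c(2)] sum_product)
  also have "\<dots> = (\<Sum>i<n. \<Sum>j<m. \<Sum>g\<in>carrier G. \<rho> g $$ (i, i) * \<psi> (inv g) $$ (j, j))"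
    by (subst sum.swap) (intro sum.cong refl sum.swap)
  also have "\<dots> = 0" by (simp add: zero)
  finally show ?thesis .
qed

text \<open>Here the averages of matrix units are scalar, and taking traces determines the scalars.\<close>

lemma trace_orthogonality_self:
  assumes \<rho>: "irreducible_representation G n \<rho>"
  shows "(\<Sum>g\<in>carrier G. mat_trace (\<rho> g) * mat_trace (\<rho> (inv g))) = of_nat (card (carrier G))"
proof -
  have r: "representation G n \<rho>" "n > 0"
    using \<rho> by (auto simp: irreducible_representation_def)
  note c = representation_carrier[OF r(1)]
  have val: "(\<Sum>g\<in>carrier G. \<rho> g $$ (i, i) * \<rho> (inv g) $$ (j, j))
      = (if j = i then of_nat (card (carrier G)) / of_nat n else 0)" if i: "i < n" and j: "j < n" for i j
  proof -
    define T where "T = mat n n (\<lambda>(k, l). \<Sum>g\<in>carrier G. \<rho> g $$ (k, i) * \<rho> (inv g) $$ (j, l))"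
    have T: "T \<in> carrier_mat n n" by (simp add: T_def)
    obtain a where a: "T = a \<cdot>\<^sub>m 1\<^sub>m n"
      using schur_scalar[OF \<rho>, of T] average_intertwines[OF r(1) r(1) i j] by (auto simp: T_def)
    have "of_nat n * a = mat_trace T"
      by (subst mat_trace_carrier[OF T]) (simp add: a)
    also have "\<dots> = (\<Sum>k<n. \<Sum>g\<in>carrier G. \<rho> g $$ (k, i) * \<rho> (inv g) $$ (j, k))"
      by (subst mat_trace_carrier[OF T]) (simp add: T_def)
    also have "\<dots> = (\<Sum>g\<in>carrier G. \<Sum>k<n. \<rho> (inv g) $$ (j, k) * \<rho> g $$ (k, i))"
      by (subst sum.swap) (simp add: mult.commute)
    also have "\<dots> = (\<Sum>g\<in>carrier G. \<rho> (inv g \<otimes> g) $$ (j, i))"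
      by (intro sum.cong refl)
        (simp only: representation_mult[OF r(1) inv_closed] index_mult_mat_sum[OF c c j i] inv_closed)
    also have "\<dots> = (if j = i then of_nat (card (carrier G)) else 0)"
      using i j by (simp add: representation_one[OF r(1)])
    finally have na: "of_nat n * a = (if j = i then of_nat (card (carrier G)) else 0)" .
    have "(\<Sum>g\<in>carrier G. \<rho> g $$ (i, i) * \<rho> (inv g) $$ (j, j)) = T $$ (i, j)"
      using i j by (simp add: T_def)
    also have "\<dots> = (if j = i then a else 0)" using i j by (simp add: a)
    also have "\<dots> = (if j = i then of_nat (card (carrier G)) / of_nat n else 0)"
      using na r(2) by (auto simp: field_simps)
    finally show ?thesis .
  qed
  have "(\<Sum>g\<in>carrier G. mat_trace (\<rho> g) * mat_trace (\<rho> (inv g)))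
    = (\<Sum>g\<in>carrier G. \<Sum>i<n. \<Sum>j<n. \<rho> g $$ (i, i) * \<rho> (inv g) $$ (j, j))"
    by (simp add: mat_trace_carrier[OF c] sum_product)
  also have "\<dots> = (\<Sum>i<n. \<Sum>j<n. \<Sum>g\<in>carrier G. \<rho> g $$ (i, i) * \<rho> (inv g) $$ (j, j))"
    by (subst sum.swap) (intro sum.cong refl sum.swap)
  also have "\<dots> = (\<Sum>i<n. \<Sum>j<n. if j = i then of_nat (card (carrier G)) / of_nat n else 0)"
    by (intro sum.cong refl) (simp add: val)
  also have "\<dots> = of_nat (card (carrier G))" using r(2) by simp
  finally show ?thesis .
qed

lemma representation_pow:
  assumes "representation G n \<rho>" "g \<in> carrier G"
  shows "\<rho> (g [^] (k :: nat)) = \<rho> g ^\<^sub>m k"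
  using assms representation_carrier[OF assms]
  by (induction k) (auto simp: representation_one representation_mult)

end

lemma upper_triangular_pow:
  fixes B :: "complex mat"
  assumes B: "B \<in> carrier_mat n n" and u: "upper_triangular B"
  shows "upper_triangular (B ^\<^sub>m k) \<and> (\<forall>i<n. (B ^\<^sub>m k) $$ (i, i) = (B $$ (i, i)) ^ k)"
proof (induction k)
  case 0 then show ?case using B by auto
next
  case (Suc k)
  let ?A = "B ^\<^sub>m k"
  have A: "?A \<in> carrier_mat n n" using B by simp
  have A0: "?A $$ (i, j) = 0" if "j < i" "i < n" for i j using Suc that A by auto
  have B0: "B $$ (i, j) = 0" if "j < i" "i < n" for i j using u that B by auto
  have "(?A * B) $$ (i, j) = 0" if ji: "j < i" "i < n" for i j
  proof -
    have "?A $$ (i, k) * B $$ (k, j) = 0" if "k < n" for k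
      using A0[of k i] B0[of j k] ji that by (cases "k < i") auto
    then have "(\<Sum>k<n. ?A $$ (i, k) * B $$ (k, j)) = 0" by (intro sum.neutral) auto
    then show ?thesis using index_mult_mat_sum[OF A B, of i j] ji by simp
  qed
  moreover have "(?A * B) $$ (i, i) = ?A $$ (i, i) * B $$ (i, i)" if i: "i < n" for i
  proof -
    have "?A $$ (i, k) * B $$ (k, i) = (if k = i then ?A $$ (i, i) * B $$ (i, i) else 0)" if "k < n" for k
      using A0[of k i] B0[of i k] i that by (cases k i rule: linorder_cases) auto
    then have "(\<Sum>k<n. ?A $$ (i, k) * B $$ (k, i)) = (\<Sum>k<n. if k = i then ?A $$ (i, i) * B $$ (i, i) else 0)"
      by (intro sum.cong) auto
    then show ?thesis using index_mult_mat_sum[OF A B i i] i by simp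
  qed
  ultimately show ?case using Suc A B by (auto simp: upper_triangular_def)
qed

text \<open>The matrix \<open>A ^\<^sub>m k\<close> is the inverse of \<open>A\<close>. The diagonal entries of a triangular form of \<open>A\<close>
are roots of unity, so inverting them amounts to complex conjugation.\<close>

lemma trace_finite_order:
  fixes A :: "complex mat"
  assumes A: "A \<in> carrier_mat n n" and pow: "A ^\<^sub>m Suc k = 1\<^sub>m n"
  shows "mat_trace (A ^\<^sub>m k) = cnj (mat_trace A)"
proof -
  obtain as where "char_poly A = (\<Prod>a\<leftarrow>as. [:- a, 1:])" using char_poly_factorized[OF A] by blast
  then obtain B where B: "B \<in> carrier_mat n n" "upper_triangular B" "similar_mat A B"
    using schur_decomposition_exists[OF A] by blast
  then obtain P Q where wit: "similar_mat_wit A B P Q" by (auto simp: similar_mat_def)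
  note PQ = similar_mat_witD2[OF A wit]
  have tr: "mat_trace (A ^\<^sub>m l) = mat_trace (B ^\<^sub>m l)" for l
  proof -
    note w = similar_mat_witD2[OF pow_carrier_mat[OF A] similar_mat_wit_pow[OF wit, of l]]
    show ?thesis using mat_trace_conjugate[OF w(5,7,6,2)] w(3) by simp
  qed
  have "similar_mat_wit (B ^\<^sub>m Suc k) (A ^\<^sub>m Suc k) Q P"
    using similar_mat_wit_sym[OF similar_mat_wit_pow[OF wit]] .
  then have "B ^\<^sub>m Suc k = Q * 1\<^sub>m n * P"
    using similar_mat_witD2(3)[OF pow_carrier_mat[OF B(1)]] pow by metis
  also have "\<dots> = 1\<^sub>m n" using PQ by simp
  finally have Bpow: "B ^\<^sub>m Suc k = 1\<^sub>m n" .
  have "(B ^\<^sub>m k) $$ (i, i) = cnj (B $$ (i, i))" if i: "i < n" for i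
  proof -
    let ?b = "B $$ (i, i)"
    have "?b ^ Suc k = 1" using upper_triangular_pow[OF B(1,2), of "Suc k"] Bpow i by (metis index_one_mat(1))
    then have "norm ?b = 1" by (metis norm_one norm_power power_eq_1_iff norm_ge_zero Suc_not_Zero)
    then have "?b * cnj ?b = 1" by (simp add: complex_norm_square[symmetric] flip: of_real_power)
    have "?b ^ k = ?b ^ k * (?b * cnj ?b)" using \<open>?b * cnj ?b = 1\<close> by simp
    also have "\<dots> = ?b ^ Suc k * cnj ?b" by (simp add: mult_ac)
    also have "\<dots> = cnj ?b" unfolding \<open>?b ^ Suc k = 1\<close> by simp
    finally have "?b ^ k = cnj ?b" .
    then show ?thesis using upper_triangular_pow[OF B(1,2), of k] i by simp
  qed
  then have "mat_trace (B ^\<^sub>m k) = cnj (mat_trace B)"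
    using B(1) by (simp add: mat_trace_carrier[of _ n])
  moreover have "mat_trace (B ^\<^sub>m k) = mat_trace (A ^\<^sub>m k)" "mat_trace B = mat_trace A"
    using tr[of k] tr[of 1] A B(1) by simp_all
  ultimately show ?thesis by simp
qed

context finite_group begin

lemma trace_inv:
  assumes r: "representation G n \<rho>" and g: "g \<in> carrier G"
  shows "mat_trace (\<rho> (inv g)) = cnj (mat_trace (\<rho> g))"
proof -
  obtain k where k: "card (carrier G) = Suc k" using card_carrier_pos gr0_implies_Suc by blast
  have one: "g [^] Suc k = \<one>" using pow_order_eq_1[OF g] k by (simp add: Coset.order_def)
  then have "g [^] k \<otimes> g = \<one>" using g by simp
  then have "inv g = g [^] k" using g by (metis inv_equality nat_pow_closed)
  then have "\<rho> (inv g) = \<rho> g ^\<^sub>m k" using representation_pow[OF r g] by simp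
  moreover have "\<rho> g ^\<^sub>m Suc k = 1\<^sub>m n"
    using representation_pow[OF r g, of "Suc k"] one representation_one[OF r] by simp
  ultimately show ?thesis using trace_finite_order[OF representation_carrier[OF r g]] by simp
qed

section \<open>Irreducible characters: orthogonality and completeness\<close>

lemma IrrE:
  assumes "\<chi> \<in> Irr G"
  obtains n \<rho> where "irreducible_representation G n \<rho>" "representation G n \<rho>" "n > 0"
    "\<chi> = character_of G \<rho>" "\<And>g. g \<in> carrier G \<Longrightarrow> \<chi> g = mat_trace (\<rho> g)"
  using assms by (auto simp: Irr_def irreducible_representation_def character_of_def)

lemma Irr_one: "\<chi> \<in> Irr G \<Longrightarrow> \<exists>n>0. \<chi> \<one> = of_nat n"
  by (elim IrrE) (auto simp: representation_one mat_trace_def)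

lemma Irr_one_nonzero: "\<chi> \<in> Irr G \<Longrightarrow> \<chi> \<one> \<noteq> 0"
  using Irr_one by fastforce

lemma Irr_conjugate:
  assumes "\<chi> \<in> Irr G" "g \<in> carrier G" "x \<in> carrier G"
  shows "\<chi> (g \<otimes> x \<otimes> inv g) = \<chi> x"
  using assms(1)
proof (rule IrrE)
  fix n \<rho> assume r: "representation G n \<rho>" and \<chi>: "\<And>g. g \<in> carrier G \<Longrightarrow> \<chi> g = mat_trace (\<rho> g)"
  have "\<rho> (inv g) * \<rho> g = 1\<^sub>m n"
    using representation_mult[OF r, of "inv g" g] representation_one[OF r] assms by simp
  then have "mat_trace (\<rho> g * \<rho> x * \<rho> (inv g)) = mat_trace (\<rho> x)"
    using assms by (intro mat_trace_conjugate[of _ n _ n]) (auto intro: representation_carrier[OF r])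
  then show ?thesis using assms by (simp add: \<chi> representation_mult[OF r])
qed

lemma Irr_orthogonality:
  assumes "\<chi> \<in> Irr G" "\<psi> \<in> Irr G"
  shows "(\<Sum>g\<in>carrier G. \<chi> g * cnj (\<psi> g)) = (if \<chi> = \<psi> then of_nat (card (carrier G)) else 0)"
proof -
  obtain n \<rho> where \<rho>: "irreducible_representation G n \<rho>" "representation G n \<rho>"
    "\<chi> = character_of G \<rho>" "\<And>g. g \<in> carrier G \<Longrightarrow> \<chi> g = mat_trace (\<rho> g)"
    by (rule IrrE[OF assms(1)], rule that)
  obtain m \<sigma> where \<sigma>: "irreducible_representation G m \<sigma>" "representation G m \<sigma>"
    "\<psi> = character_of G \<sigma>" "\<And>g. g \<in> carrier G \<Longrightarrow> \<psi> g = mat_trace (\<sigma> g)"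
    by (rule IrrE[OF assms(2)], rule that)
  show ?thesis
  proof (cases "\<chi> = \<psi>")
    case True
    have "(\<Sum>g\<in>carrier G. \<chi> g * cnj (\<psi> g)) = (\<Sum>g\<in>carrier G. mat_trace (\<rho> g) * mat_trace (\<rho> (inv g)))"
      using True by (intro sum.cong) (auto simp: \<rho>(4) trace_inv[OF \<rho>(2)] simp flip: True)
    then show ?thesis using True trace_orthogonality_self[OF \<rho>(1)] by simp
  next
    case False
    have "\<exists>g\<in>carrier G. mat_trace (\<rho> g) \<noteq> mat_trace (\<sigma> g)"
    proof (rule ccontr)
      assume "\<not> ?thesis"
      then have "\<chi> = \<psi>" unfolding \<rho>(3) \<sigma>(3) character_of_def by (intro restrict_ext) auto
      then show False using False by simp
    qed
    then have "(\<Sum>g\<in>carrier G. mat_trace (\<rho> g) * mat_trace (\<sigma> (inv g))) = 0"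
      by (rule trace_orthogonality_distinct[OF \<rho>(1) \<sigma>(1)])
    then show ?thesis using False by (simp add: \<rho>(4) \<sigma>(4) trace_inv[OF \<sigma>(2)])
  qed
qed

lemma Irr_linear_independent:
  assumes S: "finite S" "S \<subseteq> Irr G" and zero: "\<forall>g\<in>carrier G. (\<Sum>\<chi>\<in>S. c \<chi> * \<chi> g) = 0"
    and \<psi>: "\<psi> \<in> S"
  shows "c \<psi> = 0"
proof -
  have "0 = (\<Sum>g\<in>carrier G. (\<Sum>\<chi>\<in>S. c \<chi> * \<chi> g) * cnj (\<psi> g))" using zero by simp
  also have "\<dots> = (\<Sum>\<chi>\<in>S. c \<chi> * (\<Sum>g\<in>carrier G. \<chi> g * cnj (\<psi> g)))"
    unfolding sum_distrib_left sum_distrib_right mult.assoc by (rule sum.swap)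
  also have "\<dots> = (\<Sum>\<chi>\<in>S. if \<chi> = \<psi> then c \<psi> * of_nat (card (carrier G)) else 0)"
    using S \<psi> by (intro sum.cong refl) (auto simp: Irr_orthogonality subset_iff)
  also have "\<dots> = c \<psi> * of_nat (card (carrier G))" using S \<psi> by simp
  finally show ?thesis using card_carrier_pos by auto
qed

text \<open>Irreducible characters are linearly independent functions on the finite set \<open>carrier G\<close>.\<close>

lemma finite_Irr: "finite (Irr G)"
proof (rule finite_if_finite_subsets_card_bdd[THEN conjunct1])
  fix S assume S: "S \<subseteq> Irr G" "finite S"
  show "card S \<le> card (carrier G)"
  proof (rule ccontr)
    assume "\<not> ?thesis"
    then obtain c where "\<exists>\<chi>\<in>S. c \<chi> \<noteq> 0" "\<forall>g\<in>carrier G. (\<Sum>\<chi>\<in>S. c \<chi> * \<chi> g) = 0"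
      using underdetermined_system[of "carrier G" S "\<lambda>\<chi> g. \<chi> g"] S by auto
    then show False using Irr_linear_independent S by blast
  qed
qed

definition class_function :: "('a \<Rightarrow> complex) \<Rightarrow> bool"
  where "class_function f \<longleftrightarrow> (\<forall>g\<in>carrier G. \<forall>x\<in>carrier G. f (g \<otimes> x \<otimes> inv g) = f x)"

text \<open>The matrix \<open>F = \<Sum>\<^sub>g f(g) \<rho>(g)\<close> commutes with the representation because \<open>f\<close> is a class function. It
is therefore scalar, and its trace is \<open>\<chi>(f) = 0\<close>.\<close>

lemma irreducible_annihilated:
  assumes f: "class_function f" and zero: "\<And>\<chi>. \<chi> \<in> Irr G \<Longrightarrow> lin_ext G \<chi> f = 0"
    and \<rho>: "irreducible_representation G n \<rho>" and x: "x \<in> carrier G"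
  shows "(\<Sum>g\<in>carrier G. f g * mat_trace (\<rho> (g \<otimes> x))) = 0"
proof -
  have r: "representation G n \<rho>" "n > 0" using \<rho> by (auto simp: irreducible_representation_def)
  note c = representation_carrier[OF r(1)]
  define F where "F = mat n n (\<lambda>(i, j). \<Sum>g\<in>carrier G. f g * \<rho> g $$ (i, j))"
  have F: "F \<in> carrier_mat n n" by (simp add: F_def)
  have Fr: "(F * \<rho> h) $$ (i, j) = (\<Sum>g\<in>carrier G. f g * \<rho> (g \<otimes> h) $$ (i, j))"
    if h: "h \<in> carrier G" and ij: "i < n" "j < n" for h i j
  proof -
    have "(F * \<rho> h) $$ (i, j) = (\<Sum>k<n. (\<Sum>g\<in>carrier G. f g * \<rho> g $$ (i, k)) * \<rho> h $$ (k, j))"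
      unfolding index_mult_mat_sum[OF F c[OF h] ij] using ij by (simp add: F_def)
    also have "\<dots> = (\<Sum>g\<in>carrier G. f g * (\<Sum>k<n. \<rho> g $$ (i, k) * \<rho> h $$ (k, j)))"
      unfolding sum_distrib_left sum_distrib_right mult.assoc by (rule sum.swap)
    also have "\<dots> = (\<Sum>g\<in>carrier G. f g * \<rho> (g \<otimes> h) $$ (i, j))"
      using index_mult_mat_sum[OF c c[OF h] ij] representation_mult[OF r(1)] h by simp
    finally show ?thesis .
  qed
  have rF: "(\<rho> h * F) $$ (i, j) = (\<Sum>g\<in>carrier G. f g * \<rho> (h \<otimes> g) $$ (i, j))"
    if h: "h \<in> carrier G" and ij: "i < n" "j < n" for h i j
  proof -
    have "(\<rho> h * F) $$ (i, j) = (\<Sum>k<n. \<rho> h $$ (i, k) * (\<Sum>g\<in>carrier G. f g * \<rho> g $$ (k, j)))"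
      unfolding index_mult_mat_sum[OF c[OF h] F ij] using ij by (simp add: F_def)
    also have "\<dots> = (\<Sum>g\<in>carrier G. f g * (\<Sum>k<n. \<rho> h $$ (i, k) * \<rho> g $$ (k, j)))"
      unfolding sum_distrib_left by (subst sum.swap) (simp add: mult_ac)
    also have "\<dots> = (\<Sum>g\<in>carrier G. f g * \<rho> (h \<otimes> g) $$ (i, j))"
      using index_mult_mat_sum[OF c[OF h] c ij] representation_mult[OF r(1)] h by simp
    finally show ?thesis .
  qed
  have "\<rho> h * F = F * \<rho> h" if h: "h \<in> carrier G" for h
  proof (rule eq_matI)
    fix i j assume "i < dim_row (F * \<rho> h)" "j < dim_col (F * \<rho> h)"
    then have ij: "i < n" "j < n" using F c[OF h] by auto
    have cancel: "h \<otimes> (inv h \<otimes> a) = a" "inv h \<otimes> (h \<otimes> a) = a" if "a \<in> carrier G" for a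
      using h that by (simp_all add: m_assoc[symmetric])
    have "(\<Sum>g\<in>carrier G. f g * \<rho> (g \<otimes> h) $$ (i, j))
      = (\<Sum>g\<in>carrier G. f (h \<otimes> g \<otimes> inv h) * \<rho> (h \<otimes> g \<otimes> inv h \<otimes> h) $$ (i, j))"
      by (rule sum.reindex_bij_witness[of _ "\<lambda>g. h \<otimes> g \<otimes> inv h" "\<lambda>g. inv h \<otimes> g \<otimes> h"])
        (use h cancel in \<open>auto simp: m_assoc\<close>)
    also have "\<dots> = (\<Sum>g\<in>carrier G. f g * \<rho> (h \<otimes> g) $$ (i, j))"
      using f h by (intro sum.cong refl) (auto simp: class_function_def m_assoc)
    finally show "(\<rho> h * F) $$ (i, j) = (F * \<rho> h) $$ (i, j)"
      using Fr[OF h ij] rF[OF h ij] by simp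
  qed (use F c h in auto)
  then obtain a where a: "F = a \<cdot>\<^sub>m 1\<^sub>m n" using schur_scalar[OF \<rho> F] by blast
  have "of_nat n * a = mat_trace F" by (subst mat_trace_carrier[OF F]) (simp add: a)
  also have "\<dots> = (\<Sum>i<n. \<Sum>g\<in>carrier G. f g * \<rho> g $$ (i, i))"
    by (subst mat_trace_carrier[OF F]) (simp add: F_def)
  also have "\<dots> = (\<Sum>g\<in>carrier G. f g * mat_trace (\<rho> g))"
    by (subst sum.swap) (simp add: sum_distrib_left mat_trace_carrier[OF c])
  also have "\<dots> = lin_ext G (character_of G \<rho>) f"
    by (simp add: lin_ext_def character_of_def)
  also have "\<dots> = 0" using \<rho> by (intro zero) (auto simp: Irr_def)
  finally have "a = 0" using r(2) by simp
  have "(\<Sum>g\<in>carrier G. f g * mat_trace (\<rho> (g \<otimes> x)))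
    = (\<Sum>i<n. \<Sum>g\<in>carrier G. f g * \<rho> (g \<otimes> x) $$ (i, i))"
    using x by (subst sum.swap) (simp add: sum_distrib_left mat_trace_carrier[OF c])
  also have "\<dots> = (\<Sum>i<n. (F * \<rho> x) $$ (i, i))" by (simp add: Fr[OF x])
  also have "\<dots> = 0"
    unfolding a \<open>a = 0\<close> using c[OF x] by (intro sum.neutral) (auto simp: scalar_prod_def)
  finally show ?thesis .
qed

text \<open>Induction on the dimension: the trace of a reducible representation is the sum of the traces of two
smaller ones.\<close>

lemma representation_annihilated:
  assumes f: "class_function f" and zero: "\<And>\<chi>. \<chi> \<in> Irr G \<Longrightarrow> lin_ext G \<chi> f = 0"
    and x: "x \<in> carrier G"
  shows "representation G n \<rho> \<Longrightarrow> (\<Sum>g\<in>carrier G. f g * mat_trace (\<rho> (g \<otimes> x))) = 0"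
proof (induction n arbitrary: \<rho> rule: less_induct)
  case (less n)
  consider "n = 0" | "irreducible_representation G n \<rho>" | "n > 0" "\<not> irreducible_representation G n \<rho>"
    by blast
  then show ?case
  proof cases
    case 1
    then have "mat_trace (\<rho> (g \<otimes> x)) = 0" if "g \<in> carrier G" for g
      using representation_carrier[OF less.prems, of "g \<otimes> x"] x that by (simp add: mat_trace_def)
    then show ?thesis by simp
  next
    case 2 then show ?thesis using irreducible_annihilated[OF f zero _ x] by blast
  next
    case 3
    then obtain n1 n2 \<sigma>1 \<sigma>2 where s: "n1 < n" "n2 < n" "representation G n1 \<sigma>1" "representation G n2 \<sigma>2"
      "\<forall>g\<in>carrier G. mat_trace (\<rho> g) = mat_trace (\<sigma>1 g) + mat_trace (\<sigma>2 g)"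
      using reducible_trace_split[OF less.prems] by blast
    have "(\<Sum>g\<in>carrier G. f g * mat_trace (\<rho> (g \<otimes> x)))
      = (\<Sum>g\<in>carrier G. f g * mat_trace (\<sigma>1 (g \<otimes> x))) + (\<Sum>g\<in>carrier G. f g * mat_trace (\<sigma>2 (g \<otimes> x)))"
      using s(5) x by (simp add: algebra_simps sum.distrib)
    then show ?thesis using less.IH s by simp
  qed
qed

lemma regular_representation:
  "\<exists>\<rho>. representation G (card (carrier G)) \<rho> \<and>
    (\<forall>g\<in>carrier G. mat_trace (\<rho> g) = (if g = \<one> then of_nat (card (carrier G)) else 0))"
proof -
  let ?n = "card (carrier G)"
  obtain e where e: "bij_betw e {..<?n} (carrier G)"
    using ex_bij_betw_nat_finite[OF finite_carrier] by (auto simp: lessThan_atLeast0)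
  have eG: "e i \<in> carrier G" if "i < ?n" for i using e that by (auto simp: bij_betw_def)
  have einj: "e i = e j \<longleftrightarrow> i = j" if "i < ?n" "j < ?n" for i j
    using e that by (auto simp: bij_betw_def inj_on_def)
  define \<rho> where "\<rho> g = mat ?n ?n (\<lambda>(i, j). if e i = g \<otimes> e j then 1 else 0 :: complex)" for g
  have \<rho>: "\<rho> g \<in> carrier_mat ?n ?n" for g by (simp add: \<rho>_def)
  have "representation G ?n \<rho>"
  proof (rule representationI)
    show "\<rho> g \<in> carrier_mat ?n ?n" for g by (rule \<rho>)
    show "\<rho> \<one> = 1\<^sub>m ?n" by (rule eq_matI) (auto simp: \<rho>_def eG einj)
    fix g h assume g: "g \<in> carrier G" and h: "h \<in> carrier G"
    show "\<rho> (g \<otimes> h) = \<rho> g * \<rho> h"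
    proof (rule eq_matI)
      fix i j assume "i < dim_row (\<rho> g * \<rho> h)" "j < dim_col (\<rho> g * \<rho> h)"
      then have ij: "i < ?n" "j < ?n" by (auto simp: \<rho>_def)
      have "(\<rho> g * \<rho> h) $$ (i, j) = (\<Sum>k<?n. (if e i = g \<otimes> e k then 1 else 0) * (if e k = h \<otimes> e j then 1 else 0))"
        unfolding index_mult_mat_sum[OF \<rho> \<rho> ij] using ij by (simp add: \<rho>_def)
      also have "\<dots> = (\<Sum>y\<in>carrier G. (if e i = g \<otimes> y then 1 else 0) * (if y = h \<otimes> e j then 1 else 0))"
        by (rule sum.reindex_bij_betw[OF e])
      also have "\<dots> = (\<Sum>y\<in>carrier G. if y = h \<otimes> e j then (if e i = g \<otimes> (h \<otimes> e j) then 1 else 0) else 0)"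
        by (intro sum.cong) auto
      also have "\<dots> = \<rho> (g \<otimes> h) $$ (i, j)" using ij g h by (simp add: \<rho>_def eG m_assoc)
      finally show "\<rho> (g \<otimes> h) $$ (i, j) = (\<rho> g * \<rho> h) $$ (i, j)" by simp
    qed (auto simp: \<rho>_def)
  qed
  moreover have "mat_trace (\<rho> g) = (if g = \<one> then of_nat ?n else 0)" if g: "g \<in> carrier G" for g
  proof -
    have "mat_trace (\<rho> g) = (\<Sum>i<?n. if e i = g \<otimes> e i then 1 else 0)"
      by (subst mat_trace_carrier[OF \<rho>]) (simp add: \<rho>_def)
    also have "\<dots> = (\<Sum>i<?n. if g = \<one> then 1 else 0)"
    proof (intro sum.cong refl)
      fix i assume "i \<in> {..<?n}"
      then have "e i \<in> carrier G" using eG by simp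
      then have "e i = g \<otimes> e i \<longleftrightarrow> g = \<one>" using g r_cancel_one'[of "e i" g] by auto
      then show "(if e i = g \<otimes> e i then 1 else 0 :: complex) = (if g = \<one> then 1 else 0)" by simp
    qed
    finally show ?thesis by simp
  qed
  ultimately show ?thesis by blast
qed

text \<open>The trace of the regular representation is \<open>|G|\<close> at the identity and zero elsewhere, so
\<open>representation_annihilated\<close>, applied to it, isolates a single value of \<open>f\<close>.\<close>

theorem class_function_eq_zero:
  assumes f: "class_function f" and zero: "\<And>\<chi>. \<chi> \<in> Irr G \<Longrightarrow> lin_ext G \<chi> f = 0"
    and g: "g \<in> carrier G"
  shows "f g = 0"
proof -
  obtain \<rho> where \<rho>: "representation G (card (carrier G)) \<rho>"
    "\<And>g. g \<in> carrier G \<Longrightarrow> mat_trace (\<rho> g) = (if g = \<one> then of_nat (card (carrier G)) else 0)"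
    using regular_representation by blast
  have "0 = (\<Sum>x\<in>carrier G. f x * mat_trace (\<rho> (x \<otimes> inv g)))"
    using representation_annihilated[OF f zero _ \<rho>(1), of "inv g"] g by simp
  also have "\<dots> = (\<Sum>x\<in>carrier G. if x = g then f g * of_nat (card (carrier G)) else 0)"
  proof (intro sum.cong refl)
    fix x assume x: "x \<in> carrier G"
    then have "x \<otimes> inv g = \<one> \<longleftrightarrow> x = g" using g by (metis inv_solve_right' l_one one_closed)
    then show "f x * mat_trace (\<rho> (x \<otimes> inv g)) = (if x = g then f g * of_nat (card (carrier G)) else 0)"
      using x g \<rho>(2) by auto
  qed
  also have "\<dots> = f g * of_nat (card (carrier G))" using g by simp
  finally show ?thesis using card_carrier_pos by auto
qed

end

section \<open>Central characters and the sums \<open>\<sigma>\<^sub>X\<close>\<close>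

context finite_group begin

text \<open>The value at \<open>K\<close>, read as an element of the group algebra, of the central character attached
to \<open>\<chi>\<close>.\<close>

definition central_value :: "'a set \<Rightarrow> ('a \<Rightarrow> complex) \<Rightarrow> complex"
  where "central_value K \<chi> = lin_ext G \<chi> (set_hat K) / \<chi> \<one>"

lemma ClPt_level_sets: "ClPt G \<X> = level_sets \<X> (sigma G) (carrier G)"
  by (simp add: ClPt_def level_sets_def)

lemma IrPt_level_sets: "IrPt G \<K> = level_sets \<K> central_value (Irr G)"
  by (simp add: IrPt_def level_sets_def central_value_def)

lemma normal_subset_iff:
  "normal_subset G K \<longleftrightarrow> K \<subseteq> carrier G \<and> (\<forall>g\<in>carrier G. \<forall>x\<in>K. g \<otimes> x \<otimes> inv g \<in> K)"
proof
  assume "normal_subset G K"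
  then obtain \<C> where \<C>: "\<C> \<subseteq> conj_class G ` carrier G" "K = \<Union>\<C>" by (auto simp: normal_subset_def)
  show "K \<subseteq> carrier G \<and> (\<forall>g\<in>carrier G. \<forall>x\<in>K. g \<otimes> x \<otimes> inv g \<in> K)"
  proof (intro conjI ballI)
    show "K \<subseteq> carrier G" using \<C> by (auto simp: conj_class_def)
    fix g x assume g: "g \<in> carrier G" and "x \<in> K"
    then obtain y h where C: "conj_class G y \<in> \<C>" and h: "y \<in> carrier G" "h \<in> carrier G" "x = h \<otimes> y \<otimes> inv h"
      using \<C> by (auto simp: conj_class_def)
    have "g \<otimes> x \<otimes> inv g = (g \<otimes> h) \<otimes> y \<otimes> inv (g \<otimes> h)"
      using g h by (simp add: m_assoc inv_mult_group)
    then have "g \<otimes> x \<otimes> inv g \<in> conj_class G y"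
      unfolding conj_class_def using g h by blast
    then show "g \<otimes> x \<otimes> inv g \<in> K" using C \<C> by blast
  qed
next
  assume K: "K \<subseteq> carrier G \<and> (\<forall>g\<in>carrier G. \<forall>x\<in>K. g \<otimes> x \<otimes> inv g \<in> K)"
  have "x \<in> conj_class G x" if "x \<in> carrier G" for x
    unfolding conj_class_def using that by (auto intro!: exI[of _ \<one>])
  moreover have "conj_class G x \<subseteq> K" if "x \<in> K" for x
    unfolding conj_class_def using K that by auto
  ultimately have "K = \<Union>(conj_class G ` K)" using K by blast
  then show "normal_subset G K" unfolding normal_subset_def using K by (intro exI[of _ "conj_class G ` K"]) blast
qed

lemma lin_ext_set_hat: "K \<subseteq> carrier G \<Longrightarrow> lin_ext G \<chi> (set_hat K) = (\<Sum>g\<in>K. \<chi> g)"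
proof -
  assume K: "K \<subseteq> carrier G"
  have "lin_ext G \<chi> (set_hat K) = (\<Sum>g\<in>carrier G. if g \<in> K then \<chi> g else 0)"
    unfolding lin_ext_def set_hat_def by (intro sum.cong) auto
  then show ?thesis using K by (simp add: Int_absorb1 flip: sum.inter_restrict)
qed

lemma class_function_set_hat:
  assumes "normal_subset G K"
  shows "class_function (set_hat K)"
  unfolding class_function_def
proof (intro ballI)
  fix g x assume g: "g \<in> carrier G" and x: "x \<in> carrier G"
  have "x \<in> K" if y: "g \<otimes> x \<otimes> inv g \<in> K"
  proof -
    have "inv g \<otimes> (g \<otimes> x \<otimes> inv g) \<otimes> inv (inv g) \<in> K"
      using assms y g unfolding normal_subset_iff by blast
    moreover have "inv g \<otimes> (g \<otimes> x \<otimes> inv g) \<otimes> inv (inv g) = (inv g \<otimes> g) \<otimes> x \<otimes> (inv g \<otimes> g)"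
      using g x by (simp only: m_assoc inv_inv inv_closed m_closed)
    ultimately show ?thesis using g x by simp
  qed
  then show "set_hat K (g \<otimes> x \<otimes> inv g) = set_hat K x"
    using assms g unfolding normal_subset_iff set_hat_def by auto
qed

lemma sigma_conjugate:
  "X \<subseteq> Irr G \<Longrightarrow> g \<in> carrier G \<Longrightarrow> x \<in> carrier G \<Longrightarrow> sigma G X (g \<otimes> x \<otimes> inv g) = sigma G X x"
  unfolding sigma_def by (intro sum.cong) (auto simp: Irr_conjugate)

lemma Irr_one_cnj: "\<chi> \<in> Irr G \<Longrightarrow> cnj (\<chi> \<one>) = \<chi> \<one>"
  using Irr_one by fastforce

lemma sigma_pairing:
  assumes X: "X \<subseteq> Irr G" and \<chi>: "\<chi> \<in> Irr G"
  shows "(\<Sum>g\<in>carrier G. sigma G X g * cnj (\<chi> g)) = (if \<chi> \<in> X then of_nat (card (carrier G)) * \<chi> \<one> else 0)"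
proof -
  have finX: "finite X" using X finite_Irr finite_subset by blast
  have "(\<Sum>g\<in>carrier G. sigma G X g * cnj (\<chi> g)) = (\<Sum>\<psi>\<in>X. \<psi> \<one> * (\<Sum>g\<in>carrier G. \<psi> g * cnj (\<chi> g)))"
    unfolding sigma_def sum_distrib_left sum_distrib_right mult.assoc by (rule sum.swap)
  also have "\<dots> = (\<Sum>\<psi>\<in>X. if \<psi> = \<chi> then \<chi> \<one> * of_nat (card (carrier G)) else 0)"
    using X \<chi> by (intro sum.cong refl) (auto simp: Irr_orthogonality subset_iff)
  finally show ?thesis using finX by (simp add: mult.commute)
qed

lemma cnj_sigma_pairing:
  assumes X: "X \<subseteq> Irr G" and \<chi>: "\<chi> \<in> Irr G"
  shows "(\<Sum>g\<in>carrier G. cnj (sigma G X g) * \<chi> g) = (if \<chi> \<in> X then of_nat (card (carrier G)) * \<chi> \<one> else 0)"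
proof -
  have "(\<Sum>g\<in>carrier G. cnj (sigma G X g) * \<chi> g) = cnj (\<Sum>g\<in>carrier G. sigma G X g * cnj (\<chi> g))" by simp
  then show ?thesis unfolding sigma_pairing[OF X \<chi>] using Irr_one_cnj[OF \<chi>] by auto
qed

text \<open>Both sides have the same pairing with every irreducible character, so completeness applies to their
difference.\<close>

lemma class_function_expansion:
  assumes f: "class_function f" and x: "x \<in> carrier G"
  shows "f x = (\<Sum>\<chi>\<in>Irr G. lin_ext G \<chi> f / of_nat (card (carrier G)) * cnj (\<chi> x))"
proof -
  define d where "d x = f x - (\<Sum>\<chi>\<in>Irr G. lin_ext G \<chi> f / of_nat (card (carrier G)) * cnj (\<chi> x))" for x
  have N: "of_nat (card (carrier G)) \<noteq> (0 :: complex)"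
    unfolding of_nat_eq_0_iff using card_carrier_pos by linarith
  have "class_function d"
    using f unfolding class_function_def d_def by (auto simp: Irr_conjugate intro!: sum.cong)
  moreover have "lin_ext G \<psi> d = 0" if \<psi>: "\<psi> \<in> Irr G" for \<psi>
  proof -
    have "lin_ext G \<psi> d = lin_ext G \<psi> f - (\<Sum>g\<in>carrier G. (\<Sum>\<chi>\<in>Irr G. lin_ext G \<chi> f / of_nat (card (carrier G)) * cnj (\<chi> g)) * \<psi> g)"
      unfolding lin_ext_def d_def left_diff_distrib sum_subtractf ..
    also have "(\<Sum>g\<in>carrier G. (\<Sum>\<chi>\<in>Irr G. lin_ext G \<chi> f / of_nat (card (carrier G)) * cnj (\<chi> g)) * \<psi> g)
      = (\<Sum>\<chi>\<in>Irr G. lin_ext G \<chi> f / of_nat (card (carrier G)) * (\<Sum>g\<in>carrier G. \<psi> g * cnj (\<chi> g)))"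
      unfolding sum_distrib_left sum_distrib_right by (subst sum.swap) (simp add: mult_ac)
    also have "\<dots> = (\<Sum>\<chi>\<in>Irr G. if \<chi> = \<psi> then lin_ext G \<psi> f else 0)"
      using N \<psi> by (intro sum.cong refl) (auto simp: Irr_orthogonality)
    also have "\<dots> = lin_ext G \<psi> f" using \<psi> finite_Irr by simp
    finally show ?thesis by simp
  qed
  ultimately have "d x = 0" using class_function_eq_zero x by blast
  then show ?thesis by (simp add: d_def)
qed

text \<open>In the expansion of the indicator function of \<open>K\<close> the coefficient of the conjugate of \<open>\<chi>\<close> is
\<open>\<chi>(1)\<close> times a multiple of the central value; collecting the terms of one block \<open>X\<close> gives a
multiple of the conjugate of \<open>\<sigma>\<^sub>X\<close>.\<close>

lemma set_hat_expansion:
  assumes P: "partition_on (Irr G) P" and K: "normal_subset G K"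
    and const: "\<And>X \<chi> \<psi>. X \<in> P \<Longrightarrow> \<chi> \<in> X \<Longrightarrow> \<psi> \<in> X \<Longrightarrow> central_value K \<chi> = central_value K \<psi>"
  shows "\<exists>w. \<forall>g\<in>carrier G. set_hat K g = (\<Sum>X\<in>P. w X * cnj (sigma G X g))"
proof -
  define w where "w X = central_value K (SOME \<chi>. \<chi> \<in> X) / of_nat (card (carrier G))" for X
  have w: "lin_ext G \<chi> (set_hat K) / of_nat (card (carrier G)) = w X * \<chi> \<one>" if X: "X \<in> P" "\<chi> \<in> X" for X \<chi>
  proof -
    have "\<chi> \<in> Irr G" using X P by (auto simp: partition_on_def)
    moreover have "central_value K (SOME \<chi>. \<chi> \<in> X) = central_value K \<chi>"
      using const[OF X(1) someI[of "\<lambda>\<chi>. \<chi> \<in> X", OF X(2)] X(2)] .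
    ultimately show ?thesis using Irr_one_nonzero by (simp add: w_def central_value_def)
  qed
  have "set_hat K g = (\<Sum>X\<in>P. w X * cnj (sigma G X g))" if g: "g \<in> carrier G" for g
  proof -
    have "set_hat K g = (\<Sum>\<chi>\<in>Irr G. lin_ext G \<chi> (set_hat K) / of_nat (card (carrier G)) * cnj (\<chi> g))"
      using class_function_expansion[OF class_function_set_hat[OF K] g] .
    also have "\<dots> = (\<Sum>X\<in>P. \<Sum>\<chi>\<in>X. lin_ext G \<chi> (set_hat K) / of_nat (card (carrier G)) * cnj (\<chi> g))"
      by (rule sum_partition[OF P finite_Irr])
    also have "\<dots> = (\<Sum>X\<in>P. w X * cnj (sigma G X g))"
    proof (rule sum.cong[OF refl])
      fix X assume X: "X \<in> P"
      then have XI: "X \<subseteq> Irr G" using P by (auto simp: partition_on_def)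
      have "(\<Sum>\<chi>\<in>X. lin_ext G \<chi> (set_hat K) / of_nat (card (carrier G)) * cnj (\<chi> g))
        = (\<Sum>\<chi>\<in>X. w X * cnj (\<chi> \<one> * \<chi> g))"
      proof (rule sum.cong[OF refl])
        fix \<chi> assume \<chi>: "\<chi> \<in> X"
        then have "cnj (\<chi> \<one>) = \<chi> \<one>" using XI Irr_one_cnj by blast
        then show "lin_ext G \<chi> (set_hat K) / of_nat (card (carrier G)) * cnj (\<chi> g) = w X * cnj (\<chi> \<one> * \<chi> g)"
          unfolding w[OF X \<chi>] by simp
      qed
      then show "(\<Sum>\<chi>\<in>X. lin_ext G \<chi> (set_hat K) / of_nat (card (carrier G)) * cnj (\<chi> g)) = w X * cnj (sigma G X g)"
        by (simp add: sigma_def sum_distrib_left)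
    qed
    finally show ?thesis .
  qed
  then show ?thesis by blast
qed

section \<open>The maps ClPt and IrPt\<close>

lemma IrPt_partition: "partition_on (Irr G) (IrPt G \<K>)"
  unfolding IrPt_level_sets by (rule partition_on_level_sets)

lemma ClPt_partition: "partition_on (carrier G) (ClPt G \<X>)"
  unfolding ClPt_level_sets by (rule partition_on_level_sets)

lemma Union_IrPt: "\<Union>(IrPt G \<K>) = Irr G"
  unfolding IrPt_level_sets by (rule Union_level_sets)

lemma Union_ClPt: "\<Union>(ClPt G \<X>) = carrier G"
  unfolding ClPt_level_sets by (rule Union_level_sets)

lemma IrPt_blocks: "\<forall>X\<in>IrPt G \<K>. X \<subseteq> Irr G"
  using Union_IrPt[of \<K>] by blast

lemma ClPt_blocks:
  assumes "\<forall>X\<in>\<X>. X \<subseteq> Irr G"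
  shows "\<forall>K\<in>ClPt G \<X>. normal_subset G K"
proof
  fix K assume K: "K \<in> ClPt G \<X>"
  have KG: "K \<subseteq> carrier G" using K Union_ClPt[of \<X>] by blast
  have "g \<otimes> x \<otimes> inv g \<in> K" if g: "g \<in> carrier G" and x: "x \<in> K" for g x
  proof -
    have xG: "x \<in> carrier G" using x KG by blast
    show ?thesis
      using level_sets_member_iff[OF K[unfolded ClPt_level_sets] x, of "g \<otimes> x \<otimes> inv g"]
        sigma_conjugate g xG assms by simp
  qed
  then show "normal_subset G K" using KG by (auto simp: normal_subset_iff)
qed

lemma central_value_blocks:
  assumes P: "partition_on (carrier G) \<L>" and u: "union_of_blocks \<L> K"
  shows "central_value K \<chi> = (\<Sum>L\<in>{L\<in>\<L>. L \<subseteq> K}. central_value L \<chi>)"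
proof -
  have sub: "L \<subseteq> carrier G" if "L \<in> \<L>" for L using that P by (auto simp: partition_on_def)
  have "K \<subseteq> carrier G" using u P by (auto simp: union_of_blocks_def partition_on_def)
  then have "central_value K \<chi> = (\<Sum>L\<in>{L\<in>\<L>. L \<subseteq> K}. \<Sum>g\<in>L. \<chi> g) / \<chi> \<one>"
    by (simp add: central_value_def lin_ext_set_hat sum_union_of_blocks[OF P finite_carrier u])
  also have "\<dots> = (\<Sum>L\<in>{L\<in>\<L>. L \<subseteq> K}. central_value L \<chi>)"
    unfolding sum_divide_distrib[symmetric] central_value_def by (simp add: lin_ext_set_hat sub)
  finally show ?thesis .
qed

lemma IrPt_mono:
  assumes P: "partition_on (carrier G) \<L>" and u: "\<forall>K\<in>\<K>. union_of_blocks \<L> K"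
  shows "refines (Irr G) (IrPt G \<L>) (IrPt G \<K>)"
  unfolding IrPt_level_sets[of \<K>]
proof (rule refines_level_sets[OF IrPt_partition])
  fix B K \<chi> \<psi> assume B: "B \<in> IrPt G \<L>" and K: "K \<in> \<K>" and \<chi>: "\<chi> \<in> B" "\<psi> \<in> B"
  have "central_value L \<chi> = central_value L \<psi>" if "L \<in> \<L>" for L
    by (rule level_sets_const[OF B[unfolded IrPt_level_sets] \<chi> that])
  then show "central_value K \<chi> = central_value K \<psi>"
    unfolding central_value_blocks[OF P bspec[OF u K]] by (intro sum.cong) auto
qed

lemma ClPt_mono:
  assumes P: "partition_on (Irr G) \<Y>" and u: "\<forall>X\<in>\<X>. union_of_blocks \<Y> X"
  shows "refines (carrier G) (ClPt G \<Y>) (ClPt G \<X>)"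
  unfolding ClPt_level_sets[of \<X>]
proof (rule refines_level_sets[OF ClPt_partition])
  fix B X g h assume B: "B \<in> ClPt G \<Y>" and X: "X \<in> \<X>" and g: "g \<in> B" "h \<in> B"
  have "sigma G Y g = sigma G Y h" if "Y \<in> \<Y>" for Y
    by (rule level_sets_const[OF B[unfolded ClPt_level_sets] g that])
  moreover have "sigma G X x = (\<Sum>Y\<in>{Y\<in>\<Y>. Y \<subseteq> X}. sigma G Y x)" for x
    unfolding sigma_def by (rule sum_union_of_blocks[OF P finite_Irr bspec[OF u X]])
  ultimately show "sigma G X g = sigma G X h" by simp
qed

text \<open>The indicator function of \<open>K\<close> is a combination of conjugates of functions \<open>\<sigma>\<^sub>X\<close> that are constant on
the blocks of the class partition, so it is constant on these blocks as well.\<close>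

lemma union_of_blocks_ClPt_IrPt:
  assumes "\<forall>K\<in>\<K>. normal_subset G K"
  shows "\<forall>K\<in>\<K>. union_of_blocks (ClPt G (IrPt G \<K>)) K"
proof
  fix K assume K: "K \<in> \<K>"
  then have nK: "normal_subset G K" using assms by blast
  have "central_value K \<chi> = central_value K \<psi>" if "X \<in> IrPt G \<K>" "\<chi> \<in> X" "\<psi> \<in> X" for X \<chi> \<psi>
    by (rule level_sets_const[OF that(1)[unfolded IrPt_level_sets] that(2,3) K])
  then obtain w where w: "\<forall>g\<in>carrier G. set_hat K g = (\<Sum>X\<in>IrPt G \<K>. w X * cnj (sigma G X g))"
    using set_hat_expansion[OF IrPt_partition nK] by blast
  show "union_of_blocks (ClPt G (IrPt G \<K>)) K"
    unfolding ClPt_level_sets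
  proof (rule union_of_blocks_level_sets)
    show "K \<subseteq> carrier G" using nK by (simp add: normal_subset_iff)
    fix g h assume g: "g \<in> carrier G" "h \<in> carrier G" "\<forall>X\<in>IrPt G \<K>. sigma G X g = sigma G X h" "g \<in> K"
    then have "set_hat K g = set_hat K h" using w by simp
    then show "h \<in> K" using g(4) by (auto simp: set_hat_def split: if_splits)
  qed
qed

text \<open>By orthogonality the pairing of the conjugate of \<open>\<sigma>\<^sub>X\<close> with \<open>\<chi>\<close>, divided by \<open>\<chi>(1)\<close>, is \<open>|G|\<close> or
\<open>0\<close> according to whether \<open>\<chi> \<in> X\<close>. It is also a combination of central values of the blocks of
\<open>ClPt \<X>\<close>, as \<open>\<sigma>\<^sub>X\<close> is constant on them.\<close>

lemma union_of_blocks_IrPt_ClPt: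
  assumes "\<forall>X\<in>\<X>. X \<subseteq> Irr G"
  shows "\<forall>X\<in>\<X>. union_of_blocks (IrPt G (ClPt G \<X>)) X"
proof
  fix X assume X: "X \<in> \<X>"
  then have XI: "X \<subseteq> Irr G" using assms by blast
  let ?P = "ClPt G \<X>"
  define c where "c L = cnj (sigma G X (SOME g. g \<in> L))" for L
  have c: "cnj (sigma G X g) = c L" if "L \<in> ?P" "g \<in> L" for g L
    using level_sets_const[OF that(1)[unfolded ClPt_level_sets] that(2)
        someI[of "\<lambda>g. g \<in> L", OF that(2)] X] by (simp add: c_def)
  have key: "(\<Sum>L\<in>?P. c L * central_value L \<chi>) = (if \<chi> \<in> X then of_nat (card (carrier G)) else 0)"
    if \<chi>: "\<chi> \<in> Irr G" for \<chi>
  proof -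
    have sub: "L \<subseteq> carrier G" if "L \<in> ?P" for L using that Union_ClPt[of \<X>] by blast
    have "(\<Sum>g\<in>carrier G. cnj (sigma G X g) * \<chi> g) = (\<Sum>L\<in>?P. \<Sum>g\<in>L. cnj (sigma G X g) * \<chi> g)"
      by (rule sum_partition[OF ClPt_partition finite_carrier])
    also have "\<dots> = (\<Sum>L\<in>?P. c L * central_value L \<chi>) * \<chi> \<one>"
      using Irr_one_nonzero[OF \<chi>]
      by (simp add: c sub central_value_def lin_ext_set_hat sum_distrib_right flip: sum_distrib_left)
    finally show ?thesis using cnj_sigma_pairing[OF XI \<chi>] Irr_one_nonzero[OF \<chi>] by (auto split: if_splits)
  qed
  have N: "of_nat (card (carrier G)) \<noteq> (0 :: complex)"
    unfolding of_nat_eq_0_iff using card_carrier_pos by linarith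
  show "union_of_blocks (IrPt G ?P) X"
    unfolding IrPt_level_sets
  proof (rule union_of_blocks_level_sets[OF XI])
    fix \<chi> \<psi> assume I: "\<chi> \<in> Irr G" "\<psi> \<in> Irr G" and eq: "\<forall>K\<in>?P. central_value K \<chi> = central_value K \<psi>" and "\<chi> \<in> X"
    then have "(\<Sum>L\<in>?P. c L * central_value L \<psi>) = of_nat (card (carrier G))" using key[OF I(1)] by simp
    then show "\<psi> \<in> X" using key[OF I(2)] N by (auto split: if_splits)
  qed
qed

section \<open>Supercharacter theories as fixed pairs of ClPt and IrPt\<close>

lemma sigma_independent:
  assumes P: "partition_on (Irr G) \<X>" and zero: "\<forall>g\<in>carrier G. (\<Sum>X\<in>\<X>. c X * sigma G X g) = 0"
    and X: "X \<in> \<X>"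
  shows "c X = 0"
proof -
  have finX: "finite \<X>" using finite_elements[OF finite_Irr P] .
  have sub: "Y \<subseteq> Irr G" if "Y \<in> \<X>" for Y using that P by (auto simp: partition_on_def)
  obtain \<chi> where \<chi>: "\<chi> \<in> X" using X P by (metis partition_onD3 ex_in_conv)
  then have \<chi>I: "\<chi> \<in> Irr G" using X sub by blast
  have "0 = (\<Sum>g\<in>carrier G. (\<Sum>X\<in>\<X>. c X * sigma G X g) * cnj (\<chi> g))" using zero by simp
  also have "\<dots> = (\<Sum>X\<in>\<X>. c X * (\<Sum>g\<in>carrier G. sigma G X g * cnj (\<chi> g)))"
    unfolding sum_distrib_left sum_distrib_right mult.assoc by (rule sum.swap)
  also have "\<dots> = (\<Sum>Y\<in>\<X>. if \<chi> \<in> Y then c Y * (of_nat (card (carrier G)) * \<chi> \<one>) else 0)"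
    by (intro sum.cong refl) (simp add: sigma_pairing[OF sub \<chi>I])
  also have "\<dots> = c X * (of_nat (card (carrier G)) * \<chi> \<one>)"
    by (rule sum_partition_indicator[OF P finX X \<chi>])
  finally show ?thesis using Irr_one_nonzero[OF \<chi>I] card_carrier_pos by auto
qed

text \<open>The functions \<open>\<sigma>\<^sub>X\<close> are linearly independent and lie in the space of functions that are constant on
the blocks of \<open>ClPt \<X>\<close>.\<close>

lemma card_le_ClPt:
  assumes P: "partition_on (Irr G) \<X>"
  shows "card \<X> \<le> card (ClPt G \<X>)"
proof (rule ccontr)
  assume "\<not> ?thesis"
  moreover have "finite \<X>" "finite (ClPt G \<X>)"
    using finite_elements[OF finite_Irr P] finite_elements[OF finite_carrier ClPt_partition] .
  ultimately obtain c where nz: "\<exists>X\<in>\<X>. c X \<noteq> 0"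
    and c: "\<forall>L\<in>ClPt G \<X>. (\<Sum>X\<in>\<X>. c X * sigma G X (SOME g. g \<in> L)) = 0"
    using underdetermined_system[of "ClPt G \<X>" \<X> "\<lambda>X L. sigma G X (SOME g. g \<in> L)"] by auto
  have "(\<Sum>X\<in>\<X>. c X * sigma G X g) = 0" if g: "g \<in> carrier G" for g
  proof -
    obtain L where L: "L \<in> ClPt G \<X>" "g \<in> L" using g Union_ClPt[of \<X>] by blast
    have "sigma G X (SOME g. g \<in> L) = sigma G X g" if "X \<in> \<X>" for X
      by (rule level_sets_const[OF L(1)[unfolded ClPt_level_sets]
            someI[of "\<lambda>g. g \<in> L", OF L(2)] L(2) that])
    then show ?thesis using bspec[OF c L(1)] by simp
  qed
  then show False using sigma_independent[OF P] nz by blast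
qed

text \<open>A relation between the central values says that the class function \<open>\<Sum>\<^sub>K c\<^sub>K 1\<^sub>K\<close> is annihilated
by all irreducible characters, hence vanishes; its value on the nonempty set \<open>K\<close> is \<open>c\<^sub>K\<close>.\<close>

lemma central_value_independent:
  assumes P: "partition_on (carrier G) \<K>" and normal: "\<forall>K\<in>\<K>. normal_subset G K"
    and zero: "\<forall>\<chi>\<in>Irr G. (\<Sum>K\<in>\<K>. c K * central_value K \<chi>) = 0" and K: "K \<in> \<K>"
  shows "c K = 0"
proof -
  have finK: "finite \<K>" using finite_elements[OF finite_carrier P] .
  define f where "f g = (\<Sum>K\<in>\<K>. c K * set_hat K g)" for g
  have "class_function f"
    using class_function_set_hat normal unfolding class_function_def f_def
    by (auto intro!: sum.cong)
  moreover have "lin_ext G \<chi> f = 0" if \<chi>: "\<chi> \<in> Irr G" for \<chi>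
  proof -
    have "lin_ext G \<chi> f = (\<Sum>K\<in>\<K>. c K * lin_ext G \<chi> (set_hat K))"
      unfolding lin_ext_def f_def sum_distrib_left sum_distrib_right mult.assoc by (rule sum.swap)
    also have "\<dots> = (\<Sum>K\<in>\<K>. c K * central_value K \<chi>) * \<chi> \<one>"
      using Irr_one_nonzero[OF \<chi>] by (simp add: central_value_def sum_distrib_right)
    finally show ?thesis using zero \<chi> by simp
  qed
  moreover obtain g where g: "g \<in> K" using K P by (metis partition_onD3 ex_in_conv)
  moreover have "g \<in> carrier G" using K P g by (auto simp: partition_on_def)
  ultimately have "f g = 0" using class_function_eq_zero by blast
  moreover have "f g = (\<Sum>K\<in>\<K>. if g \<in> K then c K else 0)"
    unfolding f_def set_hat_def by (intro sum.cong) auto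
  ultimately show ?thesis using sum_partition_indicator[OF P finK K g] by simp
qed

lemma card_le_IrPt:
  assumes P: "partition_on (carrier G) \<K>" and normal: "\<forall>K\<in>\<K>. normal_subset G K"
  shows "card \<K> \<le> card (IrPt G \<K>)"
proof (rule ccontr)
  assume "\<not> ?thesis"
  moreover have "finite \<K>" "finite (IrPt G \<K>)"
    using finite_elements[OF finite_carrier P] finite_elements[OF finite_Irr IrPt_partition] .
  ultimately obtain c where nz: "\<exists>K\<in>\<K>. c K \<noteq> 0"
    and c: "\<forall>X\<in>IrPt G \<K>. (\<Sum>K\<in>\<K>. c K * central_value K (SOME \<chi>. \<chi> \<in> X)) = 0"
    using underdetermined_system[of "IrPt G \<K>" \<K> "\<lambda>K X. central_value K (SOME \<chi>. \<chi> \<in> X)"] by auto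
  have "(\<Sum>K\<in>\<K>. c K * central_value K \<chi>) = 0" if \<chi>: "\<chi> \<in> Irr G" for \<chi>
  proof -
    obtain X where X: "X \<in> IrPt G \<K>" "\<chi> \<in> X" using \<chi> Union_IrPt[of \<K>] by blast
    have "central_value K (SOME \<chi>. \<chi> \<in> X) = central_value K \<chi>" if "K \<in> \<K>" for K
      by (rule level_sets_const[OF X(1)[unfolded IrPt_level_sets]
            someI[of "\<lambda>\<chi>. \<chi> \<in> X", OF X(2)] X(2) that])
    then show ?thesis using bspec[OF c X(1)] by simp
  qed
  then show False using central_value_independent[OF P normal] nz by blast
qed

text \<open>In a supercharacter theory the independent functions \<open>\<sigma>\<^sub>X\<close> are as many as the superclasses, so they
span the functions constant on superclasses. In particular the indicator function of a superclass
\<open>K\<close> is a combination of them, and the coefficient of \<open>\<sigma>\<^sub>X\<close> determines the central values of \<open>K\<close> on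
\<open>X\<close>. So \<open>\<X>\<close> refines \<open>IrPt \<K>\<close>, and \<open>\<K>\<close> refines \<open>ClPt \<X>\<close> by definition; counting blocks gives
equality in both cases. Conversely, the two cardinality bounds give \<open>|\<X>| = |\<K>|\<close>.\<close>

theorem supercharacter_theory_iff:
  "supercharacter_theory G \<X> \<K> \<longleftrightarrow>
    IrPt G \<K> = \<X> \<and> ClPt G \<X> = \<K> \<and> (\<forall>K\<in>\<K>. normal_subset G K)"
proof
  assume sct: "supercharacter_theory G \<X> \<K>"
  then have P: "partition_on (Irr G) \<X>" "partition_on (carrier G) \<K>" and card: "card \<X> = card \<K>"
    and const: "\<And>X K. X \<in> \<X> \<Longrightarrow> K \<in> \<K> \<Longrightarrow> \<exists>c. \<forall>g\<in>K. sigma G X g = c"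
    by (auto simp: supercharacter_theory_def)
  have finX: "finite \<X>" using finite_elements[OF finite_Irr P(1)] .
  have finK: "finite \<K>" using finite_elements[OF finite_carrier P(2)] .
  have const': "sigma G X g = sigma G X h" if "X \<in> \<X>" "K \<in> \<K>" "g \<in> K" "h \<in> K" for X K g h
    using const[OF that(1,2)] that(3,4) by auto
  have "refines (carrier G) \<K> (ClPt G \<X>)"
    unfolding ClPt_level_sets using const' by (intro refines_level_sets[OF P(2)]) blast
  then have K: "\<K> = ClPt G \<X>"
    using refines_card_eq finK card card_le_ClPt[OF P(1)] by metis
  have XI: "\<forall>X\<in>\<X>. X \<subseteq> Irr G" using P(1) by (auto simp: partition_on_def)
  have normal: "\<forall>K\<in>\<K>. normal_subset G K" using ClPt_blocks[OF XI] by (subst K)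
  have rep: "(SOME g. g \<in> L) \<in> L" if "L \<in> \<K>" for L
    using that P(2) by (metis partition_onD3 some_in_eq)
  have "refines (Irr G) \<X> (IrPt G \<K>)"
    unfolding IrPt_level_sets
  proof (rule refines_level_sets[OF P(1)])
    fix X K \<chi> \<psi> assume X: "X \<in> \<X>" and K: "K \<in> \<K>" and \<chi>: "\<chi> \<in> X" "\<psi> \<in> X"
    \<comment> \<open>Both sides are constant on superclasses, so it suffices to compare them at representatives.\<close>
    have ext: "\<forall>g\<in>carrier G. (\<Sum>X\<in>\<X>. c X * sigma G X g) = f g"
      if c: "\<forall>L\<in>\<K>. (\<Sum>X\<in>\<X>. c X * sigma G X (SOME g. g \<in> L)) = f (SOME g. g \<in> L)"
        and f: "\<And>L g h. L \<in> \<K> \<Longrightarrow> g \<in> L \<Longrightarrow> h \<in> L \<Longrightarrow> f g = f h" for c f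
    proof
      fix g assume "g \<in> carrier G"
      then obtain L where L: "L \<in> \<K>" "g \<in> L" using P(2) by (auto simp: partition_on_def)
      have "(\<Sum>X\<in>\<X>. c X * sigma G X g) = (\<Sum>X\<in>\<X>. c X * sigma G X (SOME g. g \<in> L))"
        using const'[OF _ L(1) L(2) rep[OF L(1)]] by (intro sum.cong) auto
      also have "\<dots> = f (SOME g. g \<in> L)" using c L(1) by blast
      also have "\<dots> = f g" by (rule f[OF L(1) rep[OF L(1)] L(2)])
      finally show "(\<Sum>X\<in>\<X>. c X * sigma G X g) = f g" .
    qed
    have "\<forall>X\<in>\<X>. c X = 0" if "\<forall>L\<in>\<K>. (\<Sum>X\<in>\<X>. c X * sigma G X (SOME g. g \<in> L)) = 0" for c
      using sigma_independent[OF P(1) ext[OF that]] by blast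
    then obtain c where "\<forall>L\<in>\<K>. (\<Sum>X\<in>\<X>. c X * sigma G X (SOME g. g \<in> L)) = set_hat K (SOME g. g \<in> L)"
      using square_system_solvable[OF finX finK card, of "\<lambda>X L. sigma G X (SOME g. g \<in> L)"
        "\<lambda>L. set_hat K (SOME g. g \<in> L)"] by blast
    moreover have "set_hat K g = set_hat K h" if "L \<in> \<K>" "g \<in> L" "h \<in> L" for L g h
      using partition_on_member_eq[OF P(2) K that(1)] that by (auto simp: set_hat_def)
    ultimately have c: "\<forall>g\<in>carrier G. (\<Sum>X\<in>\<X>. c X * sigma G X g) = set_hat K g"
      by (rule ext)
    have val: "central_value K \<chi> = cnj (c X) * of_nat (card (carrier G))" if \<chi>: "\<chi> \<in> X" for \<chi>
    proof -
      have \<chi>I: "\<chi> \<in> Irr G" using \<chi> X XI by blast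
      have "set_hat K g = (\<Sum>X\<in>\<X>. cnj (c X) * cnj (sigma G X g))" if g: "g \<in> carrier G" for g
      proof -
        have "set_hat K g = cnj (set_hat K g)" by (simp add: set_hat_def)
        also have "\<dots> = cnj (\<Sum>X\<in>\<X>. c X * sigma G X g)" using c g by simp
        finally show ?thesis by simp
      qed
      then have "lin_ext G \<chi> (set_hat K) = (\<Sum>g\<in>carrier G. (\<Sum>X\<in>\<X>. cnj (c X) * cnj (sigma G X g)) * \<chi> g)"
        unfolding lin_ext_def by simp
      also have "\<dots> = (\<Sum>X\<in>\<X>. cnj (c X) * (\<Sum>g\<in>carrier G. cnj (sigma G X g) * \<chi> g))"
        unfolding sum_distrib_left sum_distrib_right mult.assoc by (rule sum.swap)
      also have "\<dots> = (\<Sum>Y\<in>\<X>. if \<chi> \<in> Y then cnj (c Y) * (of_nat (card (carrier G)) * \<chi> \<one>) else 0)"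
        using XI by (intro sum.cong refl) (simp add: cnj_sigma_pairing[OF _ \<chi>I])
      also have "\<dots> = cnj (c X) * (of_nat (card (carrier G)) * \<chi> \<one>)"
        by (rule sum_partition_indicator[OF P(1) finX X \<chi>])
      finally show ?thesis using Irr_one_nonzero[OF \<chi>I] by (simp add: central_value_def)
    qed
    show "central_value K \<chi> = central_value K \<psi>" using val \<chi> by simp
  qed
  then have "\<X> = IrPt G \<K>"
    using refines_card_eq finX card card_le_IrPt[OF P(2) normal] by metis
  then show "IrPt G \<K> = \<X> \<and> ClPt G \<X> = \<K> \<and> (\<forall>K\<in>\<K>. normal_subset G K)"
    using K normal by blast
next
  assume closed: "IrPt G \<K> = \<X> \<and> ClPt G \<X> = \<K> \<and> (\<forall>K\<in>\<K>. normal_subset G K)"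
  then have P: "partition_on (Irr G) \<X>" "partition_on (carrier G) \<K>"
    using IrPt_partition[of \<K>] ClPt_partition[of \<X>] by simp_all
  have "card \<X> = card \<K>"
    using card_le_ClPt[OF P(1)] card_le_IrPt[OF P(2)] closed by simp
  moreover have "\<exists>c. \<forall>g\<in>K. sigma G X g = c" if X: "X \<in> \<X>" and K: "K \<in> \<K>" for X K
  proof -
    have K': "K \<in> level_sets \<X> (sigma G) (carrier G)" using closed K by (simp flip: ClPt_level_sets)
    obtain g where g: "g \<in> K" using K P(2) by (metis partition_onD3 ex_in_conv)
    have "\<forall>h\<in>K. sigma G X h = sigma G X g" using level_sets_const[OF K' _ g X] by blast
    then show ?thesis by blast
  qed
  ultimately show "supercharacter_theory G \<X> \<K>" using P by (simp add: supercharacter_theory_def)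
qed

end

section \<open>Supercharacter theories containing a given superclass or character block\<close>

theorem corollary4p2:
  fixes G :: "('a, 'b) monoid_scheme"
  assumes "group G" and "finite (carrier G)"
  defines "I \<equiv> IrPt G" and "C \<equiv> ClPt G"
  shows
    "(\<forall>K. normal_subset G K \<longrightarrow>
        ((\<exists>\<X> \<K>. supercharacter_theory G \<X> \<K> \<and> K \<in> \<K>)
           \<longleftrightarrow> (\<forall>n>0. K \<in> ((C \<circ> I) ^^ n) {K}))
      \<and> ((\<exists>\<X> \<K>. supercharacter_theory G \<X> \<K> \<and> K \<in> \<K>) \<longrightarrow>
           (\<exists>N. \<forall>n\<ge>N. \<exists>\<X>. coarsest_supercharacter_theory G (\<lambda>\<Y> \<L>. K \<in> \<L>)
                                 \<X> (((C \<circ> I) ^^ n) {K}))))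
   \<and> (\<forall>X. X \<subseteq> Irr G \<longrightarrow>
        ((\<exists>\<X> \<K>. supercharacter_theory G \<X> \<K> \<and> X \<in> \<X>)
           \<longleftrightarrow> (\<forall>n>0. X \<in> ((I \<circ> C) ^^ n) {X}))
      \<and> ((\<exists>\<X> \<K>. supercharacter_theory G \<X> \<K> \<and> X \<in> \<X>) \<longrightarrow>
           (\<exists>N. \<forall>n\<ge>N. \<exists>\<K>. coarsest_supercharacter_theory G (\<lambda>\<Y> \<L>. X \<in> \<Y>)
                                 (((I \<circ> C) ^^ n) {X}) \<K>)))"
proof -
  interpret finite_group G
    using assms(1,2) by (simp add: finite_group_def finite_group_axioms_def)
  interpret classes: partition_correspondence "Irr G" "carrier G" "\<lambda>X. X \<subseteq> Irr G" "normal_subset G" I C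
    unfolding I_def C_def
    by unfold_locales
      (use IrPt_partition ClPt_partition IrPt_blocks ClPt_blocks IrPt_mono ClPt_mono
        union_of_blocks_ClPt_IrPt in auto)
  interpret characters: partition_correspondence "carrier G" "Irr G" "normal_subset G" "\<lambda>X. X \<subseteq> Irr G" C I
    unfolding I_def C_def
    by unfold_locales
      (use finite_Irr IrPt_partition ClPt_partition IrPt_blocks ClPt_blocks IrPt_mono ClPt_mono
        union_of_blocks_IrPt_ClPt in auto)
  have classes: "supercharacter_theory G \<X> \<K> \<longleftrightarrow> classes.closed_pair \<X> \<K>" for \<X> \<K>
    unfolding classes.closed_pair_def supercharacter_theory_iff unfolding I_def C_def ..
  have characters: "supercharacter_theory G \<X> \<K> \<longleftrightarrow> characters.closed_pair \<K> \<X>" for \<X> \<K>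
  proof
    assume "supercharacter_theory G \<X> \<K>"
    then show "characters.closed_pair \<K> \<X>"
      unfolding characters.closed_pair_def supercharacter_theory_iff unfolding I_def C_def
      using IrPt_blocks by blast
  next
    assume "characters.closed_pair \<K> \<X>"
    then show "supercharacter_theory G \<X> \<K>"
      unfolding characters.closed_pair_def supercharacter_theory_iff unfolding I_def C_def
      using ClPt_blocks by blast
  qed
  show ?thesis
  proof (intro conjI allI impI)
    fix K assume K: "normal_subset G K"
    show "(\<exists>\<X> \<K>. supercharacter_theory G \<X> \<K> \<and> K \<in> \<K>) \<longleftrightarrow> (\<forall>n>0. K \<in> ((C \<circ> I) ^^ n) {K})"
      using classes.ex_closed_pair_iff[OF K] unfolding classes classes.iter_def[OF K] .
    assume "\<exists>\<X> \<K>. supercharacter_theory G \<X> \<K> \<and> K \<in> \<K>"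
    then show "\<exists>N. \<forall>n\<ge>N. \<exists>\<X>. coarsest_supercharacter_theory G (\<lambda>\<Y> \<L>. K \<in> \<L>) \<X> (((C \<circ> I) ^^ n) {K})"
      using classes.coarsest_closed_pair[OF K]
      unfolding coarsest_supercharacter_theory_def classes classes.iter_def[OF K] by blast
  next
    fix X assume X: "X \<subseteq> Irr G"
    show "(\<exists>\<X> \<K>. supercharacter_theory G \<X> \<K> \<and> X \<in> \<X>) \<longleftrightarrow> (\<forall>n>0. X \<in> ((I \<circ> C) ^^ n) {X})"
      using characters.ex_closed_pair_iff[OF X] unfolding characters characters.iter_def[OF X] by blast
    assume "\<exists>\<X> \<K>. supercharacter_theory G \<X> \<K> \<and> X \<in> \<X>"
    then show "\<exists>N. \<forall>n\<ge>N. \<exists>\<K>. coarsest_supercharacter_theory G (\<lambda>\<Y> \<L>. X \<in> \<Y>) (((I \<circ> C) ^^ n) {X}) \<K>"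
      using characters.coarsest_closed_pair[OF X]
      unfolding coarsest_supercharacter_theory_def characters characters.iter_def[OF X] by blast
  qed
qed

end
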